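(* For each $\varepsilon > 0$ there is a $K$ such that for $p \ge K/\sqrt{n}$, \[ \Pr\big(G_{n,p} \text{ contains the square of a Hamilton cycle}\big) \ge 1 - \varepsilon \] for all sufficiently large $n$.
   Context: $G_{n,p}$ is the binomial random graph on vertex set $\{1,\dots,n\}$ in which each of the $\binom n2$ possible edges is present independently with probability $p$. The square of a graph $G$ is the graph on $V(G)$ in which two vertices are adjacent iff their distance in $G$ is at most $2$; the square of a Hamilton cycle of $K_n$ is the square of an $n$-vertex cycle on the vertex set of $K_n$. "$G_{n,p}$ contains the square of a Hamilton cycle" means some such graph is a subgraph of $G_{n,p}$. *)

theory Defs
  imports "HOL-Probability.Probability" "HOL-Library.Extended_Nat"
begin

text \<open>Simple graphs: an edge is a two-element set of vertices.\<close>

datatype 'a graph = Graph (verts: "'a set") (edges: "'a set set")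

definition all_edges :: "'a set \<Rightarrow> 'a set set" where
  "all_edges V = {e. e \<subseteq> V \<and> card e = 2}"

definition subgraph :: "'a graph \<Rightarrow> 'a graph \<Rightarrow> bool" where
  "subgraph H G \<longleftrightarrow> verts H \<subseteq> verts G \<and> edges H \<subseteq> edges G"

definition is_walk :: "'a graph \<Rightarrow> 'a list \<Rightarrow> bool" where
  "is_walk G xs \<longleftrightarrow> xs \<noteq> [] \<and> set xs \<subseteq> verts G \<and>
     (\<forall>i. Suc i < length xs \<longrightarrow> {xs ! i, xs ! Suc i} \<in> edges G)"

text \<open>The distance is \<open>\<infinity>\<close> if no walk joins the two vertices, since the infimum of the
  empty set in \<^typ>\<open>enat\<close> is \<open>\<infinity>\<close>.\<close>

definition graph_dist :: "'a graph \<Rightarrow> 'a \<Rightarrow> 'a \<Rightarrow> enat" where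
  "graph_dist G u v =
     Inf {enat (length xs - 1) | xs. is_walk G xs \<and> hd xs = u \<and> last xs = v}"

definition graph_square :: "'a graph \<Rightarrow> 'a graph" where
  "graph_square G = Graph (verts G)
     {{u, v} | u v. u \<in> verts G \<and> v \<in> verts G \<and> u \<noteq> v \<and> graph_dist G u v \<le> 2}"

definition is_cycle :: "'a graph \<Rightarrow> bool" where
  "is_cycle C \<longleftrightarrow> card (verts C) \<ge> 3 \<and>
     (\<exists>c. bij_betw c {..<card (verts C)} (verts C) \<and>
          edges C = {{c i, c (Suc i mod card (verts C))} | i. i < card (verts C)})"

definition contains_ham_cycle_square :: "'a graph \<Rightarrow> bool" where
  "contains_ham_cycle_square G \<longleftrightarrow>
     (\<exists>C. is_cycle C \<and> verts C = verts G \<and> subgraph (graph_square C) G)"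

text \<open>The binomial random graph; meaningful for \<open>0 \<le> p \<le> 1\<close>, as \<^const>\<open>bernoulli_pmf\<close>
  truncates its parameter to that interval.\<close>

definition gnp :: "nat \<Rightarrow> real \<Rightarrow> nat graph pmf" where
  "gnp n p = map_pmf (\<lambda>f. Graph {1..n} {e \<in> all_edges {1..n}. f e})
     (Pi_pmf (all_edges {1..n}) False (\<lambda>_. bernoulli_pmf p))"

end

theory Submission
  imports Defs "HOL-Combinatorics.Permutations" "HOL-Real_Asymp.Real_Asymp"
begin

text \<open>
  The argument of Kahn, Narayanan and Park, with minimum fragments. Copies of the squared cycle are
  indexed by permutations, and the random graph is the union of two independent ones, with edge
  probabilities of order \<open>1 / sqrt n\<close>. For a copy \<open>S\<close> and the first random graph \<open>W\<close>, the fragment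
  of \<open>S\<close> is the smallest \<open>S' - W\<close> with \<open>S'\<close> a copy inside \<open>S \<union> W\<close>. A set \<open>J\<close> of edges of a copy that
  splits into \<open>c\<close> runs lies in a proportion of at most \<open>O(1) ^ |J| * n powr (- (|J| + c) / 2)\<close> of
  all copies, and summing this over \<open>J\<close> shows that most fragments have at most \<open>sqrt n\<close> edges. The
  same sum over the nonempty subsets of a fixed fragment of that size is close to 0, so a second
  moment computation shows that the second random graph is likely to contain one of the fragments.
\<close>

section \<open>Binomial random subsets\<close>

definition bernoulli_subset_pmf :: "real \<Rightarrow> 'a set \<Rightarrow> 'a set pmf" where
  "bernoulli_subset_pmf p X =
    map_pmf (\<lambda>f. {x \<in> X. f x}) (Pi_pmf X False (\<lambda>_. bernoulli_pmf p))"

lemma set_bernoulli_subset_pmf: "set_pmf (bernoulli_subset_pmf p X) \<subseteq> Pow X"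
  by (auto simp: bernoulli_subset_pmf_def)

lemma integrable_bernoulli_subset_pmf:
  fixes f :: "'a set \<Rightarrow> real"
  assumes "finite X"
  shows "integrable (bernoulli_subset_pmf p X) f"
  using assms set_bernoulli_subset_pmf[of p X]
  by (intro integrable_measure_pmf_finite) (auto intro: finite_subset)

lemma expectation_bernoulli_subset:
  fixes f :: "'a set \<Rightarrow> real"
  assumes "finite X"
  shows "measure_pmf.expectation (bernoulli_subset_pmf p X) f =
    (\<Sum>W\<in>Pow X. f W * pmf (bernoulli_subset_pmf p X) W)"
  using assms set_bernoulli_subset_pmf[of p X] by (intro integral_measure_pmf_real) auto

lemma prob_bernoulli_subset:
  assumes "finite X"
  shows "measure_pmf.prob (bernoulli_subset_pmf p X) {W. P W} =
    (\<Sum>W | W \<subseteq> X \<and> P W. pmf (bernoulli_subset_pmf p X) W)"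
proof -
  have "measure_pmf.prob (bernoulli_subset_pmf p X) {W. P W} =
      measure_pmf.expectation (bernoulli_subset_pmf p X) (indicator {W. P W})"
    by simp
  also have "\<dots> = (\<Sum>W | W \<subseteq> X \<and> P W. pmf (bernoulli_subset_pmf p X) W)"
    unfolding expectation_bernoulli_subset[OF assms] using assms
    by (intro sum.mono_neutral_cong_right) auto
  finally show ?thesis .
qed

lemma pmf_bernoulli_subset:
  assumes "finite X" "0 \<le> p" "p \<le> 1" "W \<subseteq> X"
  shows "pmf (bernoulli_subset_pmf p X) W = p ^ card W * (1 - p) ^ card (X - W)"
proof -
  have "(\<lambda>f. {x \<in> X. f x}) -` {W} = Pi X (\<lambda>x. {x \<in> W})"
    using assms(4) by auto
  then have "pmf (bernoulli_subset_pmf p X) W =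
      (\<Prod>x\<in>X. measure_pmf.prob (bernoulli_pmf p) {x \<in> W})"
    using assms(1) by (simp add: bernoulli_subset_pmf_def pmf_map measure_Pi_pmf_Pi)
  also have "\<dots> = (\<Prod>x\<in>X. if x \<in> W then p else 1 - p)"
    using assms(2,3) by (intro prod.cong) (auto simp: measure_pmf_single)
  also have "\<dots> = p ^ card (X \<inter> W) * (1 - p) ^ card (X \<inter> - W)"
    using assms(1) by (subst prod.If_cases) auto
  finally show ?thesis
    using assms(4) by (simp add: Int_absorb1 Diff_eq)
qed

lemma pmf_bernoulli_subset_le_Un:
  assumes "finite X" "0 < p" "p \<le> 1" "W \<subseteq> X" "T \<subseteq> X" "T \<inter> W = {}"
  shows "pmf (bernoulli_subset_pmf p X) W \<le>
    (1 / p) ^ card T * pmf (bernoulli_subset_pmf p X) (W \<union> T)"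
proof -
  have "card (W \<union> T) = card W + card T"
    using assms by (intro card_Un_disjoint) (auto intro: finite_subset)
  then have "(1 / p) ^ card T * p ^ card (W \<union> T) = p ^ card W"
    using assms(2) by (simp add: power_add power_one_over)
  moreover have "(1 - p) ^ card (X - W) \<le> (1 - p) ^ card (X - (W \<union> T))"
    using assms by (intro power_decreasing card_mono) auto
  ultimately show ?thesis
    using assms by (simp add: pmf_bernoulli_subset mult_left_mono flip: mult.assoc)
qed

lemma measure_bind_pmf:
  "measure_pmf.prob (bind_pmf M f) A = measure_pmf.expectation M (\<lambda>x. measure_pmf.prob (f x) A)"
  unfolding measure_pmf_bind using measurable_measure_pmf[of f]
  by (intro measure_pmf.measure_bind[where N = "count_space UNIV"]) auto

lemma prob_bernoulli_subset_superset:
  assumes "finite X" "0 \<le> p" "p \<le> 1" "T \<subseteq> X"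
  shows "measure_pmf.prob (bernoulli_subset_pmf p X) {W. T \<subseteq> W} = p ^ card T"
proof -
  have "(\<lambda>f. {x \<in> X. f x}) -` {W. T \<subseteq> W} = Pi X (\<lambda>x. if x \<in> T then {True} else UNIV)"
    using assms(4) by (auto split: if_splits)
  then have "measure_pmf.prob (bernoulli_subset_pmf p X) {W. T \<subseteq> W} =
      (\<Prod>x\<in>X. measure_pmf.prob (bernoulli_pmf p) (if x \<in> T then {True} else UNIV))"
    using assms(1) by (simp add: bernoulli_subset_pmf_def measure_Pi_pmf_Pi)
  also have "\<dots> = (\<Prod>x\<in>X. if x \<in> T then p else 1)"
    using assms(2,3) by (intro prod.cong) (auto simp: measure_pmf_single)
  also have "\<dots> = p ^ card (X \<inter> T)"
    using assms(1) by (subst prod.If_cases) auto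
  finally show ?thesis
    using assms(4) by (simp add: Int_absorb1)
qed

lemma bernoulli_pmf_disj:
  assumes "0 \<le> p" "p \<le> 1" "0 \<le> q" "q \<le> 1" "1 - r = (1 - p) * (1 - q)"
  shows "bernoulli_pmf r =
    bind_pmf (bernoulli_pmf p) (\<lambda>a. bind_pmf (bernoulli_pmf q) (\<lambda>b. return_pmf (a \<or> b)))"
proof (rule pmf_eqI)
  fix c
  have "0 \<le> (1 - p) * (1 - q)" "(1 - p) * (1 - q) \<le> 1"
    using assms(1-4) by (auto intro: mult_le_one)
  then have "0 \<le> r" "r \<le> 1"
    using assms(5) by auto
  moreover have "r = p + (1 - p) * q"
    using assms(5) by algebra
  ultimately show "pmf (bernoulli_pmf r) c = pmf (bind_pmf (bernoulli_pmf p)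
      (\<lambda>a. bind_pmf (bernoulli_pmf q) (\<lambda>b. return_pmf (a \<or> b)))) c"
    using assms by (cases c) (simp_all add: pmf_bind measure_pmf_single)
qed

lemma bernoulli_subset_pmf_Un:
  assumes "finite X" "0 \<le> p" "p \<le> 1" "0 \<le> q" "q \<le> 1"
    and "1 - r = (1 - p) * (1 - q)"
  shows "bernoulli_subset_pmf r X =
    bind_pmf (bernoulli_subset_pmf p X) (\<lambda>W. map_pmf ((\<union>) W) (bernoulli_subset_pmf q X))"
proof -
  let ?Pi = "\<lambda>p. Pi_pmf X False (\<lambda>_. bernoulli_pmf p)"
  have "?Pi r =
    bind_pmf (?Pi p) (\<lambda>f. map_pmf (\<lambda>g x. if x \<in> X then f x \<or> g x else False) (?Pi q))"
    unfolding bernoulli_pmf_disj[OF assms(2-)]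
    using assms(1) by (simp add: Pi_pmf_bind[where d' = False] map_pmf_def)
  moreover have "{x \<in> X. if x \<in> X then f x \<or> g x else False} = {x \<in> X. f x} \<union> {x \<in> X. g x}" for f g
    by auto
  ultimately show ?thesis
    by (simp add: bernoulli_subset_pmf_def map_bind_pmf bind_map_pmf map_pmf_comp)
qed

lemma map_image_bernoulli_subset_pmf:
  assumes "inj f" "finite X"
  shows "map_pmf (image f) (bernoulli_subset_pmf p X) = bernoulli_subset_pmf p (f ` X)"
proof -
  have "Pi_pmf X False (\<lambda>_. bernoulli_pmf p) =
      map_pmf (\<lambda>g. g \<circ> f) (Pi_pmf (f ` X) False (\<lambda>_. bernoulli_pmf p))"
    using assms by (intro Pi_pmf_bij_betw) (auto simp: bij_betw_def inj_def inj_on_def)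
  moreover have "f ` {x \<in> X. g (f x)} = {y \<in> f ` X. g y}" for g
    by auto
  ultimately show ?thesis
    by (simp add: bernoulli_subset_pmf_def map_pmf_comp)
qed

definition normalized_inclusion :: "real \<Rightarrow> 'a set \<Rightarrow> 'a set \<Rightarrow> real" where
  "normalized_inclusion p T W = (1 / p) ^ card T * indicator {W. T \<subseteq> W} W"

lemma expectation_normalized_inclusion_mult:
  assumes "finite X" "0 < p" "p \<le> 1" "S \<subseteq> X" "T \<subseteq> X"
  shows "measure_pmf.expectation (bernoulli_subset_pmf p X)
      (\<lambda>W. normalized_inclusion p S W * normalized_inclusion p T W) = (1 / p) ^ card (S \<inter> T)"
proof -
  have "finite S" "finite T"
    using assms finite_subset by blast+
  then have card: "card S + card T = card (S \<inter> T) + card (S \<union> T)"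
    by (metis add.commute card_Un_Int)
  have "normalized_inclusion p S W * normalized_inclusion p T W =
      (1 / p) ^ (card S + card T) * indicator {W. S \<union> T \<subseteq> W} W" for W
    by (simp add: normalized_inclusion_def power_add indicator_def)
  then have "measure_pmf.expectation (bernoulli_subset_pmf p X)
      (\<lambda>W. normalized_inclusion p S W * normalized_inclusion p T W) =
      (1 / p) ^ (card S + card T) * p ^ card (S \<union> T)"
    using prob_bernoulli_subset_superset[of X p "S \<union> T"] assms by simp
  also have "\<dots> = (1 / p) ^ card (S \<inter> T)"
    using assms(2) by (simp add: card power_add power_one_over)
  finally show ?thesis .
qed

lemma expectation_normalized_inclusion:
  assumes "finite X" "0 < p" "p \<le> 1" "T \<subseteq> X"
  shows "measure_pmf.expectation (bernoulli_subset_pmf p X) (normalized_inclusion p T) = 1"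
  using expectation_normalized_inclusion_mult[OF assms(1-3) empty_subsetI assms(4)]
  by (simp add: normalized_inclusion_def[abs_def])

lemma prob_zero_le_variance:
  fixes Y :: "'a \<Rightarrow> real"
  assumes "integrable (measure_pmf M) (\<lambda>x. (Y x)\<^sup>2)" "0 < measure_pmf.expectation M Y"
  shows "measure_pmf.prob M {x. Y x = 0} \<le>
    measure_pmf.variance M Y / (measure_pmf.expectation M Y)\<^sup>2"
proof -
  let ?\<mu> = "measure_pmf.expectation M Y"
  have "measure_pmf.prob M {x. Y x = 0} \<le> measure_pmf.prob M {x. ?\<mu> \<le> \<bar>Y x - ?\<mu>\<bar>}"
    by (intro measure_pmf.finite_measure_mono) auto
  also have "\<dots> \<le> measure_pmf.variance M Y / ?\<mu>\<^sup>2"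
    using measure_pmf.Chebyshev_inequality[of Y M ?\<mu>] assms by simp
  finally show ?thesis .
qed

lemma prob_bernoulli_subset_second_moment:
  assumes X: "finite X" "0 < p" "p \<le> 1" and G: "finite G" "G \<noteq> {}"
    and T: "\<And>i. i \<in> G \<Longrightarrow> T i \<subseteq> X"
    and corr: "(\<Sum>i\<in>G. \<Sum>j\<in>G. (1 / p) ^ card (T i \<inter> T j)) \<le> (1 + \<delta>) * (real (card G))\<^sup>2"
  shows "1 - \<delta> \<le> measure_pmf.prob (bernoulli_subset_pmf p X) {W. \<exists>i\<in>G. T i \<subseteq> W}"
proof -
  let ?M = "bernoulli_subset_pmf p X" and ?N = "real (card G)"
  define Y where "Y W = (\<Sum>i\<in>G. normalized_inclusion p (T i) W)" for W
  have N: "0 < ?N"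
    using G by (simp add: card_gt_0_iff)
  have int: "integrable ?M f" for f :: "'a set \<Rightarrow> real"
    using X(1) by (rule integrable_bernoulli_subset_pmf)
  have mean: "measure_pmf.expectation ?M Y = ?N"
    by (simp add: Y_def[abs_def] int expectation_normalized_inclusion X T)
  have "measure_pmf.expectation ?M (\<lambda>W. (Y W)\<^sup>2) = (\<Sum>i\<in>G. \<Sum>j\<in>G. (1 / p) ^ card (T i \<inter> T j))"
    by (simp add: Y_def power2_eq_square sum_product int expectation_normalized_inclusion_mult X T)
  then have variance: "measure_pmf.variance ?M Y \<le> \<delta> * ?N\<^sup>2"
    using corr measure_pmf.variance_eq[of ?M Y] by (simp add: int mean distrib_right)
  have "Y W = 0" if "\<not> (\<exists>i\<in>G. T i \<subseteq> W)" for W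
    unfolding Y_def using that by (intro sum.neutral) (auto simp: normalized_inclusion_def)
  then have "measure_pmf.prob ?M (- {W. \<exists>i\<in>G. T i \<subseteq> W}) \<le> measure_pmf.prob ?M {W. Y W = 0}"
    by (intro measure_pmf.finite_measure_mono) auto
  also have "\<dots> \<le> measure_pmf.variance ?M Y / ?N\<^sup>2"
    using prob_zero_le_variance[of ?M Y] int N by (simp add: mean)
  also have "\<dots> \<le> \<delta>"
    using variance N by (simp add: pos_divide_le_eq)
  finally show ?thesis
    using measure_pmf.prob_compl[of "{W. \<exists>i\<in>G. T i \<subseteq> W}" ?M] by (simp add: Compl_eq_Diff_UNIV)
qed

section \<open>Minimum fragments\<close>

definition codegree :: "('i \<Rightarrow> 'a set) \<Rightarrow> 'i set \<Rightarrow> 'a set \<Rightarrow> nat" where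
  "codegree S I T = card {i \<in> I. T \<subseteq> S i}"

lemma codegree_antimono: "finite I \<Longrightarrow> T \<subseteq> U \<Longrightarrow> codegree S I U \<le> codegree S I T"
  unfolding codegree_def by (rule card_mono) auto

definition spread_sum :: "real \<Rightarrow> ('i \<Rightarrow> 'a set) \<Rightarrow> 'i set \<Rightarrow> nat \<Rightarrow> 'a set \<Rightarrow> real" where
  "spread_sum p S I k A = (\<Sum>T | T \<subseteq> A \<and> k \<le> card T. (1 / p) ^ card T * real (codegree S I T))"

lemma spread_sum_antimono:
  assumes "0 < p" "p \<le> q"
  shows "spread_sum q S I k A \<le> spread_sum p S I k A"
  unfolding spread_sum_def using assms
  by (intro sum_mono mult_right_mono power_mono) (auto simp: frac_le)

lemma sum_spread_sum_singleton:
  assumes "finite I"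
  shows "(\<Sum>i\<in>I. spread_sum p S {i} k A) = spread_sum p S I k A"
proof -
  have "real (codegree S I T) = (\<Sum>i\<in>I. real (codegree S {i} T))" for T
  proof -
    have "card {j \<in> {i}. T \<subseteq> S j} = (if T \<subseteq> S i then 1 else 0)" for i
      by (simp add: Collect_conv_if)
    then show ?thesis
      using assms by (simp add: codegree_def sum.If_cases Int_def flip: of_nat_sum)
  qed
  then show ?thesis
    by (simp add: spread_sum_def sum_distrib_left) (rule sum.swap)
qed

lemma spread_sum_mono:
  assumes "0 \<le> p" "finite I" "G \<subseteq> I"
  shows "spread_sum p S G k A \<le> spread_sum p S I k A"
  unfolding spread_sum_def codegree_def using assms
  by (intro sum_mono mult_left_mono of_nat_mono card_mono) auto

lemma spread_sum_nonneg: "0 \<le> p \<Longrightarrow> 0 \<le> spread_sum p S I k A"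
  by (simp add: spread_sum_def sum_nonneg)

lemma spread_sum_singleton:
  assumes "finite A"
  shows "spread_sum p S {i} k A = (\<Sum>T | T \<subseteq> A \<and> T \<subseteq> S i \<and> k \<le> card T. (1 / p) ^ card T)"
proof -
  have "finite {T. T \<subseteq> A \<and> k \<le> card T}"
    using assms by (auto intro: finite_subset[of _ "Pow A"])
  then show ?thesis
    unfolding spread_sum_def
    by (intro sum.mono_neutral_cong_right) (auto simp: codegree_def Collect_conv_if)
qed

definition fragment :: "('i \<Rightarrow> 'a set) \<Rightarrow> 'i set \<Rightarrow> 'i \<Rightarrow> 'a set \<Rightarrow> 'a set" where
  "fragment S I i W = arg_min card (\<lambda>T. \<exists>j\<in>I. S j \<subseteq> S i \<union> W \<and> T = S j - W)"

lemma ex_member_fragment_eq: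
  assumes "i \<in> I"
  shows "\<exists>j\<in>I. S j \<subseteq> S i \<union> W \<and> fragment S I i W = S j - W"
  unfolding fragment_def by (rule arg_min_natI[where k = "S i - W"]) (use assms in blast)

lemma card_fragment_le:
  assumes "j \<in> I" "S j \<subseteq> S i \<union> W"
  shows "card (fragment S I i W) \<le> card (S j - W)"
  unfolding fragment_def by (rule arg_min_nat_le) (use assms in blast)

lemma fragment_subset: "i \<in> I \<Longrightarrow> fragment S I i W \<subseteq> S i"
  using ex_member_fragment_eq[of i I S W] by auto

lemma fragment_Int_empty: "i \<in> I \<Longrightarrow> fragment S I i W \<inter> W = {}"
  using ex_member_fragment_eq[of i I S W] by auto

lemma ex_member_subset_fragment: "i \<in> I \<Longrightarrow> \<exists>j\<in>I. S j \<subseteq> W \<union> fragment S I i W"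
  using ex_member_fragment_eq[of i I S W] by auto

lemma fragment_subset_member:
  assumes "i \<in> I" "finite (S i)" "j \<in> I" "S j \<subseteq> W \<union> fragment S I i W"
  shows "fragment S I i W \<subseteq> S j"
proof -
  have "finite (fragment S I i W)"
    using assms(1,2) fragment_subset finite_subset by metis
  moreover have "S j - W \<subseteq> fragment S I i W"
    using assms(4) by auto
  moreover have "card (fragment S I i W) \<le> card (S j - W)"
    using assms(1,3,4) fragment_subset[of i I S W] by (intro card_fragment_le) auto
  ultimately have "S j - W = fragment S I i W"
    by (rule card_seteq)
  then show ?thesis
    by auto
qed

lemma fragment_subset_chosen_member:
  assumes "i \<in> I" "finite (S i)"
    and r: "\<And>Z. r Z \<in> I" "\<And>j Z. j \<in> I \<Longrightarrow> S j \<subseteq> Z \<Longrightarrow> S (r Z) \<subseteq> Z"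
  shows "fragment S I i W \<subseteq> S (r (W \<union> fragment S I i W))"
proof -
  obtain j where "j \<in> I" "S j \<subseteq> W \<union> fragment S I i W"
    using ex_member_subset_fragment[of i I S W] assms(1) by blast
  then have "S (r (W \<union> fragment S I i W)) \<subseteq> W \<union> fragment S I i W"
    by (rule r(2))
  with assms(1,2) r(1) show ?thesis
    by (rule fragment_subset_member)
qed

text \<open>
  All members contained in \<open>Z = W \<union> T\<close>, where \<open>T\<close> is the fragment of \<open>(i, W)\<close>, contain \<open>T\<close>.
  So once a member \<open>S (r Z)\<close> has been chosen as a function of \<open>Z\<close>, the pair \<open>(W, T)\<close> is determined
  by \<open>Z\<close> and a subset of that member.
\<close>

lemma prob_large_fragment_le:
  fixes p :: real
  assumes X: "finite X" "0 < p" "p \<le> 1" and S: "\<And>i. i \<in> I \<Longrightarrow> S i \<subseteq> X" and i: "i \<in> I"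
    and r: "\<And>Z. r Z \<in> I" "\<And>j Z. j \<in> I \<Longrightarrow> S j \<subseteq> Z \<Longrightarrow> S (r Z) \<subseteq> Z"
  shows "measure_pmf.prob (bernoulli_subset_pmf p X) {W. k \<le> card (fragment S I i W)} \<le>
    measure_pmf.expectation (bernoulli_subset_pmf p X) (\<lambda>Z. spread_sum p S {i} k (S (r Z)))"
proof -
  let ?\<mu> = "pmf (bernoulli_subset_pmf p X)"
  define C where "C Z = {T. T \<subseteq> S (r Z) \<and> T \<subseteq> S i \<and> k \<le> card T}" for Z
  have fin_S: "finite (S j)" if "j \<in> I" for j
    using S[OF that] X(1) finite_subset by blast
  have fin_C: "finite (C Z)" for Z
    using fin_S[OF i] by (auto simp: C_def intro: finite_subset[of _ "Pow (S i)"])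
  have "measure_pmf.prob (bernoulli_subset_pmf p X) {W. k \<le> card (fragment S I i W)} =
      (\<Sum>W | W \<subseteq> X \<and> k \<le> card (fragment S I i W). ?\<mu> W)"
    using X(1) by (rule prob_bernoulli_subset)
  also have "\<dots> \<le> (\<Sum>(Z, T)\<in>(SIGMA Z:Pow X. C Z). (1 / p) ^ card T * ?\<mu> Z)"
  proof (rule sum_le_included[where i = "\<lambda>(Z, T). Z - T"])
    show "\<forall>W\<in>{W. W \<subseteq> X \<and> k \<le> card (fragment S I i W)}. \<exists>y\<in>(SIGMA Z:Pow X. C Z).
      (\<lambda>(Z, T). Z - T) y = W \<and> ?\<mu> W \<le> (case y of (Z, T) \<Rightarrow> (1 / p) ^ card T * ?\<mu> Z)"
    proof (clarify)
      fix W assume W: "W \<subseteq> X" "k \<le> card (fragment S I i W)"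
      define T where "T = fragment S I i W"
      have T: "T \<subseteq> S i" "T \<inter> W = {}"
        unfolding T_def using i by (rule fragment_subset, rule fragment_Int_empty)
      have "T \<subseteq> S (r (W \<union> T))"
        unfolding T_def by (rule fragment_subset_chosen_member[where S = S, OF i fin_S[OF i] r])
      then have "(W \<union> T, T) \<in> (SIGMA Z:Pow X. C Z)"
        using W T S[OF i] by (auto simp: C_def T_def)
      moreover have "?\<mu> W \<le> (1 / p) ^ card T * ?\<mu> (W \<union> T)"
        using X W T S[OF i] by (intro pmf_bernoulli_subset_le_Un) auto
      moreover have "W \<union> T - T = W"
        using T(2) by auto
      ultimately show "\<exists>y\<in>(SIGMA Z:Pow X. C Z). (\<lambda>(Z, T). Z - T) y = W \<and>
          ?\<mu> W \<le> (case y of (Z, T) \<Rightarrow> (1 / p) ^ card T * ?\<mu> Z)"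
        by (intro bexI[of _ "(W \<union> T, T)"]) auto
    qed
  qed (use X fin_C in auto)
  also have "\<dots> = (\<Sum>Z\<in>Pow X. (\<Sum>T\<in>C Z. (1 / p) ^ card T) * ?\<mu> Z)"
    using X(1) fin_C by (simp add: sum.Sigma sum_distrib_right)
  finally show ?thesis
    by (simp add: expectation_bernoulli_subset[OF X(1)] spread_sum_singleton fin_S r(1) C_def)
qed

lemma expectation_card_large_fragments_le:
  fixes p :: real
  assumes X: "finite X" "0 < p" "p \<le> 1" and I: "finite I" "I \<noteq> {}"
    and S: "\<And>i. i \<in> I \<Longrightarrow> S i \<subseteq> X"
    and B: "\<And>j. j \<in> I \<Longrightarrow> spread_sum p S I k (S j) \<le> B"
  shows "measure_pmf.expectation (bernoulli_subset_pmf p X)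
    (\<lambda>W. card {i \<in> I. k \<le> card (fragment S I i W)}) \<le> B"
proof -
  let ?M = "bernoulli_subset_pmf p X"
  have int: "integrable ?M f" for f :: "'a set \<Rightarrow> real"
    using X(1) by (rule integrable_bernoulli_subset_pmf)
  have "\<exists>i\<in>I. (\<exists>j\<in>I. S j \<subseteq> Z) \<longrightarrow> S i \<subseteq> Z" for Z
    using I(2) by blast
  then obtain r where r: "\<And>Z. r Z \<in> I" "\<And>j Z. j \<in> I \<Longrightarrow> S j \<subseteq> Z \<Longrightarrow> S (r Z) \<subseteq> Z"
    by metis
  have "measure_pmf.expectation ?M (\<lambda>W. card {i \<in> I. k \<le> card (fragment S I i W)}) =
      measure_pmf.expectation ?M (\<lambda>W. \<Sum>i\<in>I. indicator {W. k \<le> card (fragment S I i W)} W)"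
    using I by (simp add: indicator_def sum.If_cases Int_def)
  also have "\<dots> = (\<Sum>i\<in>I. measure_pmf.prob ?M {W. k \<le> card (fragment S I i W)})"
    by (subst Bochner_Integration.integral_sum) (auto simp: int)
  also have "\<dots> \<le> (\<Sum>i\<in>I. measure_pmf.expectation ?M (\<lambda>Z. spread_sum p S {i} k (S (r Z))))"
    by (intro sum_mono prob_large_fragment_le X S r)
  also have "\<dots> = measure_pmf.expectation ?M (\<lambda>Z. spread_sum p S I k (S (r Z)))"
    by (simp add: int sum_spread_sum_singleton[OF I(1), symmetric])
  also have "\<dots> \<le> measure_pmf.expectation ?M (\<lambda>_. B)"
    using B r(1) by (intro integral_mono int) auto
  finally show ?thesis
    by simp
qed

lemma inverse_power_card_Int_le:
  fixes p :: real
  assumes "0 \<le> p" "finite A" "T \<subseteq> S i"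
  shows "(1 / p) ^ card (A \<inter> T) \<le> 1 + spread_sum p S {i} 1 A"
proof (cases "A \<inter> T = {}")
  case True
  then show ?thesis
    using assms(1) by (simp add: spread_sum_nonneg)
next
  case False
  let ?C = "{U. U \<subseteq> A \<and> U \<subseteq> S i \<and> 1 \<le> card U}"
  have "A \<inter> T \<in> ?C"
    using assms False by (auto simp: Suc_le_eq card_gt_0_iff)
  moreover have "finite ?C"
    using assms(2) by (auto intro: finite_subset[of _ "Pow A"])
  ultimately have "(1 / p) ^ card (A \<inter> T) \<le> (\<Sum>U\<in>?C. (1 / p) ^ card U)"
    using assms(1) by (intro member_le_sum) auto
  then show ?thesis
    by (simp add: spread_sum_singleton assms(2))
qed

lemma prob_contains_small_subset_ge:
  fixes p \<beta> :: real
  assumes X: "finite X" "0 < p" "p \<le> 1" and I: "finite I" "G \<subseteq> I" "G \<noteq> {}" "card I \<le> 2 * card G"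
    and S: "\<And>i. i \<in> I \<Longrightarrow> S i \<subseteq> X" and T: "\<And>i. i \<in> G \<Longrightarrow> T i \<subseteq> S i"
    and \<beta>: "\<And>i. i \<in> G \<Longrightarrow> spread_sum p S I 1 (T i) \<le> \<beta> * card I"
  shows "1 - 2 * \<beta> \<le> measure_pmf.prob (bernoulli_subset_pmf p X) {W. \<exists>i\<in>G. T i \<subseteq> W}"
proof (rule prob_bernoulli_subset_second_moment)
  obtain i where "i \<in> G"
    using I(3) by blast
  then have "0 \<le> \<beta> * card I" "0 < card I"
    using order_trans[OF spread_sum_nonneg \<beta>] X(2) I(1,2) by (auto simp: card_gt_0_iff)
  then have nonneg: "0 \<le> \<beta>"
    by (simp add: zero_le_mult_iff)
  show "T i \<subseteq> X" if "i \<in> G" for i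
    using S T I(2) that by blast
  then have fin_T: "finite (T i)" if "i \<in> G" for i
    using X(1) that finite_subset by blast
  have "(\<Sum>j\<in>G. (1 / p) ^ card (T i \<inter> T j)) \<le> card G + \<beta> * card I" if i: "i \<in> G" for i
  proof -
    have "(\<Sum>j\<in>G. (1 / p) ^ card (T i \<inter> T j)) \<le> (\<Sum>j\<in>G. 1 + spread_sum p S {j} 1 (T i))"
      using X(2) T fin_T[OF i] by (intro sum_mono inverse_power_card_Int_le) auto
    also have "\<dots> = card G + spread_sum p S G 1 (T i)"
      using finite_subset[OF I(2,1)] by (simp add: sum.distrib sum_spread_sum_singleton)
    also have "\<dots> \<le> card G + \<beta> * card I"
      using spread_sum_mono[of p I G S 1 "T i"] X(2) I(1,2) \<beta>[OF i] by simp
    finally show ?thesis .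
  qed
  then have "(\<Sum>i\<in>G. \<Sum>j\<in>G. (1 / p) ^ card (T i \<inter> T j)) \<le> (\<Sum>i\<in>G. card G + \<beta> * card I)"
    by (rule sum_mono)
  also have "\<dots> = card G * (card G + \<beta> * card I)"
    by simp
  also have "\<dots> \<le> card G * (card G + \<beta> * (2 * card G))"
    using I(4) nonneg by (intro mult_left_mono add_left_mono) auto
  also have "\<dots> = (1 + 2 * \<beta>) * (card G)\<^sup>2"
    by (simp add: power2_eq_square algebra_simps)
  finally show "(\<Sum>i\<in>G. \<Sum>j\<in>G. (1 / p) ^ card (T i \<inter> T j)) \<le> (1 + 2 * \<beta>) * (real (card G))\<^sup>2"
    by simp
  show "finite G"
    using I finite_subset by blast
qed (use X I in auto)

lemma prob_many_large_fragments_le: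
  fixes p \<alpha> :: real
  assumes X: "finite X" "0 < p" "p \<le> 1" and I: "finite I" "I \<noteq> {}"
    and S: "\<And>i. i \<in> I \<Longrightarrow> S i \<subseteq> X"
    and large: "\<And>i. i \<in> I \<Longrightarrow> spread_sum p S I k (S i) \<le> \<alpha> * card I"
  shows "measure_pmf.prob (bernoulli_subset_pmf p X)
    {W. real (card I) / 2 \<le> card {i \<in> I. k \<le> card (fragment S I i W)}} \<le> 2 * \<alpha>"
proof -
  let ?M = "bernoulli_subset_pmf p X" and ?f = "\<lambda>W. card {i \<in> I. k \<le> card (fragment S I i W)}"
  have "measure_pmf.prob ?M {W. real (card I) / 2 \<le> ?f W} \<le>
      measure_pmf.expectation ?M ?f / (real (card I) / 2)"
    using integral_Markov_inequality_measure[of ?M ?f UNIV "real (card I) / 2"]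
      I integrable_bernoulli_subset_pmf[OF X(1)] by (simp add: card_gt_0_iff)
  also have "\<dots> \<le> \<alpha> * card I / (real (card I) / 2)"
    by (intro divide_right_mono expectation_card_large_fragments_le X I S large) auto
  also have "\<dots> = 2 * \<alpha>"
    using I by simp
  finally show ?thesis .
qed

lemma prob_completes_member_ge:
  fixes q \<beta> :: real
  assumes X: "finite X" "0 < q" "q \<le> 1" and I: "finite I"
    and S: "\<And>i. i \<in> I \<Longrightarrow> S i \<subseteq> X"
    and small: "\<And>i T. i \<in> I \<Longrightarrow> T \<subseteq> S i \<Longrightarrow> card T < k \<Longrightarrow> spread_sum q S I 1 T \<le> \<beta> * card I"
    and few: "2 * card {i \<in> I. k \<le> card (fragment S I i W)} < card I"
  shows "1 - 2 * \<beta> \<le> measure_pmf.prob (bernoulli_subset_pmf q X) {W'. \<exists>i\<in>I. S i \<subseteq> W \<union> W'}"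
proof -
  let ?T = "\<lambda>i. fragment S I i W" and ?M = "bernoulli_subset_pmf q X"
  define G where "G = {i \<in> I. card (?T i) < k}"
  have "card I = card ({i \<in> I. k \<le> card (?T i)} \<union> G)"
    by (rule arg_cong[where f = card]) (auto simp: G_def)
  also have "\<dots> \<le> card {i \<in> I. k \<le> card (?T i)} + card G"
    by (rule card_Un_le)
  finally have card_G: "card I < 2 * card G"
    using few by simp
  have "1 - 2 * \<beta> \<le> measure_pmf.prob ?M {W'. \<exists>i\<in>G. ?T i \<subseteq> W'}"
  proof (rule prob_contains_small_subset_ge)
    show "?T i \<subseteq> S i" if "i \<in> G" for i
      using that fragment_subset[of i I S W] by (auto simp: G_def)
    then show "spread_sum q S I 1 (?T i) \<le> \<beta> * card I" if "i \<in> G" for i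
      using that by (intro small[of i]) (auto simp: G_def)
    show "G \<noteq> {}"
      using card_G by auto
  qed (use X I S card_G in \<open>auto simp: G_def\<close>)
  also have "\<dots> \<le> measure_pmf.prob ?M {W'. \<exists>i\<in>I. S i \<subseteq> W \<union> W'}"
  proof -
    have "\<exists>j\<in>I. S j \<subseteq> W \<union> W'" if i: "i \<in> G" and T: "?T i \<subseteq> W'" for i W'
    proof -
      obtain j where "j \<in> I" "S j \<subseteq> W \<union> ?T i"
        using ex_member_subset_fragment[of i I S W] i by (auto simp: G_def)
      then show ?thesis
        using T by blast
    qed
    then show ?thesis
      by (intro measure_pmf.finite_measure_mono) auto
  qed
  finally show ?thesis .
qed

lemma prob_contains_member_ge:
  fixes p q r \<alpha> \<beta> :: real
  assumes X: "finite X" and I: "finite I" "I \<noteq> {}" and S: "\<And>i. i \<in> I \<Longrightarrow> S i \<subseteq> X"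
    and p: "0 < p" "p \<le> 1" and q: "0 < q" "q \<le> 1"
    and r: "1 - r = (1 - p) * (1 - q)"
    and large: "\<And>i. i \<in> I \<Longrightarrow> spread_sum p S I k (S i) \<le> \<alpha> * card I"
    and small: "\<And>i T. i \<in> I \<Longrightarrow> T \<subseteq> S i \<Longrightarrow> card T < k \<Longrightarrow> spread_sum q S I 1 T \<le> \<beta> * card I"
    and nonneg: "0 \<le> \<beta>"
  shows "1 - 2 * \<alpha> - 2 * \<beta> \<le> measure_pmf.prob (bernoulli_subset_pmf r X) {W. \<exists>i\<in>I. S i \<subseteq> W}"
proof -
  let ?P = "bernoulli_subset_pmf p X" and ?Q = "bernoulli_subset_pmf q X"
  define Bad where "Bad = {W. real (card I) / 2 \<le> card {i \<in> I. k \<le> card (fragment S I i W)}}"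
  have "measure_pmf.prob ?P Bad \<le> 2 * \<alpha>"
    unfolding Bad_def by (intro prob_many_large_fragments_le X p I S large)
  then have "1 - 2 * \<alpha> - 2 * \<beta> \<le> measure_pmf.prob ?P (- Bad) - 2 * \<beta>"
    using measure_pmf.prob_compl[of Bad ?P] by (simp add: Compl_eq_Diff_UNIV)
  also have "\<dots> = measure_pmf.expectation ?P (\<lambda>W. indicator (- Bad) W - 2 * \<beta>)"
    by (simp add: integrable_bernoulli_subset_pmf X)
  also have "\<dots> \<le> measure_pmf.expectation ?P (\<lambda>W. measure_pmf.prob ?Q {W'. \<exists>i\<in>I. S i \<subseteq> W \<union> W'})"
  proof (intro integral_mono integrable_bernoulli_subset_pmf X)
    fix W
    show "indicator (- Bad) W - 2 * \<beta> \<le> measure_pmf.prob ?Q {W'. \<exists>i\<in>I. S i \<subseteq> W \<union> W'}"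
    proof (cases "W \<in> Bad")
      case True
      then show ?thesis
        using nonneg by (simp add: order_trans[OF _ measure_nonneg])
    next
      case False
      then have "2 * card {i \<in> I. k \<le> card (fragment S I i W)} < card I"
        by (simp add: Bad_def)
      then have "1 - 2 * \<beta> \<le> measure_pmf.prob ?Q {W'. \<exists>i\<in>I. S i \<subseteq> W \<union> W'}"
        by (intro prob_completes_member_ge X q I S small)
      then show ?thesis
        using False by simp
    qed
  qed
  also have "\<dots> = measure_pmf.prob (bernoulli_subset_pmf r X) {W. \<exists>i\<in>I. S i \<subseteq> W}"
    using X p q r by (simp add: bernoulli_subset_pmf_Un[of X p q r] measure_bind_pmf vimage_def)
  finally show ?thesis .
qed

section \<open>Runs of integers\<close>

definition run_starts :: "nat \<Rightarrow> nat set \<Rightarrow> nat set" where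
  "run_starts g J = {a \<in> J. \<forall>b\<in>J. b < a \<longrightarrow> b + g < a}"

definition run_weight :: "nat \<Rightarrow> real \<Rightarrow> real \<Rightarrow> nat set \<Rightarrow> real" where
  "run_weight g l m J = l ^ card J * m ^ card (run_starts g J)"

lemma run_starts_subset: "run_starts g J \<subseteq> J"
  by (auto simp: run_starts_def)

lemma run_weight_empty [simp]: "run_weight g l m {} = 1"
  by (simp add: run_weight_def run_starts_def)

lemma run_weight_nonneg: "0 \<le> l \<Longrightarrow> 0 \<le> m \<Longrightarrow> 0 \<le> run_weight g l m J"
  by (simp add: run_weight_def)

lemma power_card_mult_run_weight: "c ^ card J * run_weight g l m J = run_weight g (c * l) m J"
  by (simp add: run_weight_def power_mult_distrib)

lemma run_weight_insert_greater:
  assumes "J \<subseteq> {..<a}"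
  shows "run_weight g l m (insert a J) =
    (if \<exists>b\<in>J. a \<le> b + g then l else l * m) * run_weight g l m J"
proof -
  have fin: "finite J" "finite (run_starts g J)"
    using assms run_starts_subset[of g J] by (meson finite_lessThan finite_subset order_trans)+
  have "a \<notin> J" "a \<notin> run_starts g J"
    using assms run_starts_subset[of g J] by auto
  moreover have "run_starts g (insert a J) =
      (if \<exists>b\<in>J. a \<le> b + g then run_starts g J else insert a (run_starts g J))"
    using assms by (auto simp: run_starts_def not_le)
  ultimately show ?thesis
    using fin by (simp add: run_weight_def)
qed

lemma run_weight_Diff_le:
  assumes "finite J" "finite D" "0 \<le> l" "l \<le> 1" "0 \<le> m" "m \<le> 1"
  shows "(l * m) ^ card D * run_weight g l m (J - D) \<le> run_weight g l m J"
proof -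
  have card_le: "card A \<le> card D + card B" if "A - D \<subseteq> B" "finite B" for A B
    using diff_card_le_card_Diff[OF assms(2), of A] card_mono[OF that(2,1)] by linarith
  have "card (run_starts g J) \<le> card D + card (run_starts g (J - D))"
    using assms(1) run_starts_subset[of g "J - D"]
    by (intro card_le) (auto simp: run_starts_def)
  moreover have "card J \<le> card D + card (J - D)"
    using assms(1) by (intro card_le) auto
  ultimately have "l ^ (card D + card (J - D)) * m ^ (card D + card (run_starts g (J - D))) \<le>
      run_weight g l m J"
    unfolding run_weight_def using assms by (intro mult_mono power_decreasing) auto
  then show ?thesis
    by (simp add: run_weight_def power_add power_mult_distrib mult_ac)
qed

lemma sum_close_to_le:
  fixes f :: "nat set \<Rightarrow> real"
  assumes "\<And>J. 0 \<le> f J"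
  shows "(\<Sum>J | J \<subseteq> T \<inter> {..<a} \<and> (\<exists>b\<in>J. a \<le> b + g). f J) \<le>
    (\<Sum>c\<in>{a - g..<a}. \<Sum>J\<in>Pow (T \<inter> {..<c}). f (insert c J))"
proof -
  let ?N = "{J. J \<subseteq> T \<inter> {..<a} \<and> (\<exists>b\<in>J. a \<le> b + g)}"
  let ?Q = "SIGMA c:{a - g..<a}. Pow (T \<inter> {..<c})"
  have "sum f ?N \<le> (\<Sum>(c, J)\<in>?Q. f (insert c J))"
  proof (rule sum_le_included[where i = "\<lambda>(c, J). insert c J"])
    show "finite ?N"
      by (rule finite_subset[of _ "Pow (T \<inter> {..<a})"]) auto
    show "\<forall>J\<in>?N. \<exists>y\<in>?Q. (case y of (c, J) \<Rightarrow> insert c J) = J \<and>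
        f J \<le> (case y of (c, J) \<Rightarrow> f (insert c J))"
    proof
      fix J assume J: "J \<in> ?N"
      then obtain b where b: "b \<in> J" "a \<le> b + g"
        by auto
      have "J \<subseteq> {..<a}"
        using J by auto
      then have fin: "finite J"
        by (rule finite_subset) simp
      have Max: "Max J \<in> J" "\<And>x. x \<in> J \<Longrightarrow> x \<le> Max J"
        using fin b(1) by (auto intro: Max_in)
      have "Max J \<in> {a - g..<a}"
        using b Max J by fastforce
      moreover have "J - {Max J} \<subseteq> T \<inter> {..<Max J}"
        using J Max(2) by (fastforce simp: less_le)
      moreover have "insert (Max J) (J - {Max J}) = J"
        using Max(1) by auto
      ultimately show "\<exists>y\<in>?Q. (case y of (c, J) \<Rightarrow> insert c J) = J \<and>
          f J \<le> (case y of (c, J) \<Rightarrow> f (insert c J))"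
        by (intro bexI[of _ "(Max J, J - {Max J})"]) auto
    qed
  qed (use assms in auto)
  then show ?thesis
    by (simp add: sum.Sigma)
qed

lemma sum_run_weight_insert_close_le:
  assumes "0 \<le> l" "0 \<le> m"
  shows "(\<Sum>J\<in>Pow (T \<inter> {..<a}). run_weight g l m (insert a J)) \<le>
    l * m * (\<Sum>J\<in>Pow (T \<inter> {..<a}). run_weight g l m J) +
    l * (\<Sum>J | J \<subseteq> T \<inter> {..<a} \<and> (\<exists>b\<in>J. a \<le> b + g). run_weight g l m J)"
proof -
  let ?w = "run_weight g l m" and ?P = "Pow (T \<inter> {..<a})"
  define N where "N = {J. J \<subseteq> T \<inter> {..<a} \<and> (\<exists>b\<in>J. a \<le> b + g)}"
  have "(\<Sum>J\<in>?P. ?w (insert a J)) \<le> (\<Sum>J\<in>?P. l * m * ?w J + (if J \<in> N then l * ?w J else 0))"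
    using assms run_weight_nonneg[OF assms]
    by (intro sum_mono) (auto simp: N_def run_weight_insert_greater)
  moreover have "(\<Sum>J\<in>?P. if J \<in> N then l * ?w J else 0) = (\<Sum>J\<in>N. l * ?w J)"
    by (intro sum.mono_neutral_cong_right) (auto simp: N_def)
  ultimately show ?thesis
    by (simp add: sum.distrib sum_distrib_left N_def)
qed

text \<open>
  If \<open>a\<close> does not start a run, then the largest element below \<open>a\<close> is one of \<open>a - g, \<dots>, a - 1\<close>, and
  the bound for these applies.
\<close>

lemma sum_run_weight_insert_le:
  assumes "0 \<le> l" "2 * real g * l \<le> 1" "0 \<le> m"
  shows "(\<Sum>J\<in>Pow (T \<inter> {..<a}). run_weight g l m (insert a J)) \<le>
    2 * l * m * (\<Sum>J\<in>Pow (T \<inter> {..<a}). run_weight g l m J)"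
proof (induction a rule: less_induct)
  case (less a)
  let ?w = "run_weight g l m"
  define P where "P c = Pow (T \<inter> {..<c})" for c
  have w: "0 \<le> ?w J" for J
    using assms by (simp add: run_weight_nonneg)
  then have sum_w: "0 \<le> sum ?w (P a)"
    by (rule sum_nonneg)
  have "(\<Sum>J | J \<subseteq> T \<inter> {..<a} \<and> (\<exists>b\<in>J. a \<le> b + g). ?w J) \<le>
      (\<Sum>c\<in>{a - g..<a}. \<Sum>J\<in>P c. ?w (insert c J))"
    unfolding P_def by (rule sum_close_to_le) (rule w)
  also have "\<dots> \<le> (\<Sum>c\<in>{a - g..<a}. 2 * l * m * sum ?w (P a))"
  proof (rule sum_mono)
    fix c assume "c \<in> {a - g..<a}"
    then have "(\<Sum>J\<in>P c. ?w (insert c J)) \<le> 2 * l * m * sum ?w (P c)" "P c \<subseteq> P a"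
      using less[of c] by (auto simp: P_def)
    then show "(\<Sum>J\<in>P c. ?w (insert c J)) \<le> 2 * l * m * sum ?w (P a)"
      using assms w by (elim order_trans) (intro mult_left_mono sum_mono2, auto simp: P_def)
  qed
  also have "\<dots> \<le> g * (2 * l * m * sum ?w (P a))"
    using assms sum_w by (auto intro!: mult_right_mono)
  finally have close: "(\<Sum>J | J \<subseteq> T \<inter> {..<a} \<and> (\<exists>b\<in>J. a \<le> b + g). ?w J) \<le>
    g * (2 * l * m * sum ?w (P a))" .
  have "(\<Sum>J\<in>P a. ?w (insert a J)) \<le> l * m * sum ?w (P a) + l * (g * (2 * l * m * sum ?w (P a)))"
    unfolding P_def using assms close[unfolded P_def]
    by (intro order_trans[OF sum_run_weight_insert_close_le] add_left_mono mult_left_mono)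
  also have "\<dots> = l * m * sum ?w (P a) + (2 * g * l) * (l * m * sum ?w (P a))"
    by simp
  also have "\<dots> \<le> l * m * sum ?w (P a) + 1 * (l * m * sum ?w (P a))"
    using assms sum_w by (intro add_left_mono mult_right_mono) auto
  finally show ?case
    by (simp add: P_def)
qed

lemma sum_run_weight_le:
  assumes "finite T" "0 \<le> l" "2 * real g * l \<le> 1" "0 \<le> m"
  shows "(\<Sum>J\<in>Pow T. run_weight g l m J) \<le> exp (2 * l * m * card T)"
  using assms(1)
proof (induction T rule: finite_linorder_max_induct)
  case (insert a T)
  let ?w = "run_weight g l m"
  have T: "T \<inter> {..<a} = T" and a: "a \<notin> T"
    using insert.hyps(2) by auto
  have "sum ?w (Pow (insert a T)) = sum ?w (Pow T) + sum ?w (insert a ` Pow T)"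
    unfolding Pow_insert using insert.hyps(1) a by (intro sum.union_disjoint) auto
  also have "sum ?w (insert a ` Pow T) = (\<Sum>J\<in>Pow T. ?w (insert a J))"
    using a by (subst sum.reindex) (auto simp: inj_on_def)
  also have "sum ?w (Pow T) + \<dots> \<le> sum ?w (Pow T) + 2 * l * m * sum ?w (Pow T)"
    using sum_run_weight_insert_le[OF assms(2-4), where T = T and a = a] by (simp add: T)
  also have "\<dots> = (1 + 2 * l * m) * sum ?w (Pow T)"
    by (simp add: distrib_right)
  also have "\<dots> \<le> exp (2 * l * m) * exp (2 * l * m * card T)"
    using insert.IH assms by (intro mult_mono exp_ge_add_one_self sum_nonneg run_weight_nonneg) auto
  finally show ?case
    using insert.hyps(1) a by (simp add: algebra_simps flip: exp_add)
qed simp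

lemma sum_large_run_weight_le:
  assumes "finite T" "0 \<le> l" "4 * real g * l \<le> 1" "0 \<le> m"
  shows "(\<Sum>J | J \<subseteq> T \<and> k \<le> card J. run_weight g l m J) \<le> (1 / 2) ^ k * exp (4 * l * m * card T)"
proof -
  have "(\<Sum>J | J \<subseteq> T \<and> k \<le> card J. run_weight g l m J) \<le>
      (\<Sum>J | J \<subseteq> T \<and> k \<le> card J. (1 / 2) ^ k * run_weight g (2 * l) m J)"
  proof (rule sum_mono)
    fix J assume J: "J \<in> {J. J \<subseteq> T \<and> k \<le> card J}"
    have "run_weight g l m J = (1 / 2) ^ card J * run_weight g (2 * l) m J"
      by (simp add: power_card_mult_run_weight)
    also have "\<dots> \<le> (1 / 2) ^ k * run_weight g (2 * l) m J"
      using J assms by (intro mult_right_mono power_decreasing run_weight_nonneg) auto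
    finally show "run_weight g l m J \<le> (1 / 2) ^ k * run_weight g (2 * l) m J" .
  qed
  also have "\<dots> \<le> (\<Sum>J\<in>Pow T. (1 / 2) ^ k * run_weight g (2 * l) m J)"
    using assms by (intro sum_mono2 mult_nonneg_nonneg run_weight_nonneg) auto
  also have "\<dots> = (1 / 2) ^ k * (\<Sum>J\<in>Pow T. run_weight g (2 * l) m J)"
    by (simp add: sum_distrib_left)
  also have "\<dots> \<le> (1 / 2) ^ k * exp (2 * (2 * l) * m * card T)"
    using assms by (intro mult_left_mono sum_run_weight_le) auto
  finally show ?thesis
    by simp
qed

lemma sum_nonempty_run_weight_le:
  assumes "finite T" "0 \<le> l" "2 * real g * l \<le> 1" "0 \<le> m"
  shows "(\<Sum>J | J \<subseteq> T \<and> 1 \<le> card J. run_weight g l m J) \<le> exp (2 * l * m * card T) - 1"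
proof -
  have "{J. J \<subseteq> T \<and> 1 \<le> card J} = Pow T - {{}}"
    using assms(1) finite_subset by (auto simp: Suc_le_eq card_gt_0_iff)
  then have "(\<Sum>J | J \<subseteq> T \<and> 1 \<le> card J. run_weight g l m J) = (\<Sum>J\<in>Pow T. run_weight g l m J) - 1"
    using assms(1) by (simp add: sum_diff1)
  then show ?thesis
    using sum_run_weight_le[OF assms] by simp
qed

lemma power_le_run_weight:
  fixes b x :: real
  assumes b: "1 \<le> b" "b \<le> x" and "finite J" and m: "card J + card (run_starts g J) \<le> 2 * m"
  shows "(b / x) ^ m \<le> run_weight g (b / sqrt x) (1 / sqrt x) J"
proof -
  let ?s = "card (run_starts g J)"
  have s: "?s \<le> card J"
    using \<open>finite J\<close> run_starts_subset by (rule card_mono)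
  have "(b / x) ^ m = (sqrt b / sqrt x) ^ (2 * m)"
    using b by (simp add: power_mult power_divide)
  also have "\<dots> \<le> (sqrt b / sqrt x) ^ (card J + ?s)"
    using b m by (intro power_decreasing) auto
  also have "\<dots> = sqrt b ^ (card J + ?s) * (1 / sqrt x) ^ (card J + ?s)"
    by (simp add: power_divide)
  also have "\<dots> \<le> sqrt b ^ (2 * card J) * (1 / sqrt x) ^ (card J + ?s)"
    using b s by (intro mult_right_mono power_increasing) auto
  also have "sqrt b ^ (2 * card J) = b ^ card J"
    using b by (simp add: power_mult)
  finally show ?thesis
    by (simp add: run_weight_def power_add power_divide)
qed

lemma sum_subsets_image_le:
  fixes h w :: "_ set \<Rightarrow> real"
  assumes A: "finite A" and hw: "\<And>J. J \<subseteq> A \<Longrightarrow> inj_on f J \<Longrightarrow> h (f ` J) \<le> w J"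
    and w: "\<And>J. J \<subseteq> A \<Longrightarrow> 0 \<le> w J"
  shows "(\<Sum>T | T \<subseteq> f ` A \<and> k \<le> card T. h T) \<le> (\<Sum>J | J \<subseteq> A \<and> k \<le> card J. w J)"
proof (rule sum_le_included[where i = "image f"])
  show "finite {T. T \<subseteq> f ` A \<and> k \<le> card T}"
    by (rule finite_subset[of _ "Pow (f ` A)"]) (use A in auto)
  show "finite {J. J \<subseteq> A \<and> k \<le> card J}"
    by (rule finite_subset[of _ "Pow A"]) (use A in auto)
  show "\<forall>T\<in>{T. T \<subseteq> f ` A \<and> k \<le> card T}. \<exists>J\<in>{J. J \<subseteq> A \<and> k \<le> card J}. f ` J = T \<and> h T \<le> w J"
  proof clarify
    fix T assume T: "T \<subseteq> f ` A" "k \<le> card T"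
    then obtain J where J: "J \<subseteq> A" "inj_on f J" "T = f ` J"
      by (auto simp: subset_image_inj)
    moreover have "card T = card J"
      using J by (simp add: card_image)
    ultimately show "\<exists>J\<in>{J. J \<subseteq> A \<and> k \<le> card J}. f ` J = T \<and> h T \<le> w J"
      using T(2) hw by auto
  qed
qed (use w in auto)

lemma spread_sum_image_le:
  fixes b p :: real
  assumes p: "0 < p" and A: "finite A"
    and codegree: "\<And>J. J \<subseteq> A \<Longrightarrow> codegree S I (f ` J) \<le> b * run_weight g l m J"
  shows "spread_sum p S I k (f ` A) \<le> b * (\<Sum>J | J \<subseteq> A \<and> k \<le> card J. run_weight g (l / p) m J)"
proof -
  let ?w = "\<lambda>J. (1 / p) ^ card J * (b * run_weight g l m J)"
  have "spread_sum p S I k (f ` A) \<le> (\<Sum>J | J \<subseteq> A \<and> k \<le> card J. ?w J)"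
    unfolding spread_sum_def
  proof (rule sum_subsets_image_le[OF A])
    fix J assume J: "J \<subseteq> A"
    show "0 \<le> ?w J"
      using order_trans[OF of_nat_0_le_iff codegree[OF J]] p by simp
    show "(1 / p) ^ card (f ` J) * real (codegree S I (f ` J)) \<le> ?w J" if "inj_on f J"
      using codegree[OF J] p by (simp add: card_image[OF that] mult_left_mono)
  qed
  also have "?w = (\<lambda>J. b * run_weight g (l / p) m J)"
    using power_card_mult_run_weight[of "1 / p" _ g l m] by (simp add: fun_eq_iff)
  finally show ?thesis
    by (simp add: sum_distrib_left)
qed

section \<open>Permutations mapping a forest into a graph of bounded degree\<close>

definition endpoints :: "('a \<times> 'a) list \<Rightarrow> 'a set" where
  "endpoints ps = fst ` set ps \<union> snd ` set ps"

lemma endpoints_Nil [simp]: "endpoints [] = {}"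
  by (simp add: endpoints_def)

lemma endpoints_Cons [simp]: "endpoints ((x, y) # ps) = insert x (insert y (endpoints ps))"
  by (auto simp: endpoints_def)

lemma finite_endpoints [simp]: "finite (endpoints ps)"
  by (simp add: endpoints_def)

lemma in_endpoints: "(x, y) \<in> set ps \<Longrightarrow> x \<in> endpoints ps" "(x, y) \<in> set ps \<Longrightarrow> y \<in> endpoints ps"
  by (force simp: endpoints_def)+

lemma card_endpoints_le: "card (endpoints ps) \<le> 2 * length ps"
proof (induction ps)
  case (Cons e ps)
  then show ?case
    by (cases e) (simp add: card_insert_if)
qed simp

fun forest :: "('a \<times> 'a) list \<Rightarrow> bool" where
  "forest [] \<longleftrightarrow> True"
| "forest ((x, y) # ps) \<longleftrightarrow> x \<noteq> y \<and> x \<notin> endpoints ps \<and> forest ps"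

definition perms_into :: "'a set \<Rightarrow> 'a set set \<Rightarrow> ('a \<times> 'a) list \<Rightarrow> ('a \<Rightarrow> 'a) set" where
  "perms_into V E ps = {\<phi>. \<phi> permutes V \<and> (\<forall>(x, y)\<in>set ps. {\<phi> x, \<phi> y} \<in> E)}"

lemma finite_perms_into: "finite V \<Longrightarrow> finite (perms_into V E ps)"
  by (rule finite_subset[OF _ finite_permutations[of V]]) (auto simp: perms_into_def)

lemma perms_into_transpose:
  assumes \<phi>: "\<phi> \<in> perms_into V E ps" and xz: "x \<in> V" "z \<in> V" "x \<notin> endpoints ps" "z \<notin> endpoints ps"
  shows "\<phi> \<circ> Transposition.transpose x z \<in> perms_into V E ps"
proof -
  have "Transposition.transpose x z u = u" if "u \<in> endpoints ps" for u
    using that xz by (intro transpose_apply_other) auto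
  then have "{(\<phi> \<circ> Transposition.transpose x z) u, (\<phi> \<circ> Transposition.transpose x z) v} \<in> E"
    if "(u, v) \<in> set ps" for u v
    using \<phi> in_endpoints[OF that] that by (auto simp: perms_into_def)
  moreover have "\<phi> \<circ> Transposition.transpose x z permutes V"
    using \<phi> xz by (intro permutes_compose permutes_swap_id) (auto simp: perms_into_def)
  ultimately show ?thesis
    by (auto simp: perms_into_def)
qed

lemma card_permuted_neighbours_le:
  assumes V: "finite V" "u \<in> V" and \<psi>: "\<psi> permutes V"
    and deg: "\<And>u. u \<in> V \<Longrightarrow> card {v \<in> V. {v, u} \<in> E} \<le> d"
  shows "card {z \<in> V. {\<psi> z, \<psi> u} \<in> E} \<le> d"
proof -
  have "card {z \<in> V. {\<psi> z, \<psi> u} \<in> E} \<le> card {v \<in> V. {v, \<psi> u} \<in> E}"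
    using V(1) permutes_inj_on[OF \<psi>] permutes_in_image[OF \<psi>]
    by (intro card_inj_on_le[of \<psi>]) auto
  also have "\<dots> \<le> d"
    using deg permutes_in_image[OF \<psi>] V(2) by blast
  finally show ?thesis .
qed

text \<open>
  Switching: exchange the image of the leaf \<open>x\<close> with that of any vertex \<open>z\<close> outside the rest of the
  forest. Given \<open>z\<close>, this is reversible, and \<open>z\<close> is now mapped to a neighbour of the image of \<open>y\<close>.
\<close>

lemma card_perms_into_Cons:
  assumes V: "finite V" and xy: "x \<in> V" "y \<in> V" "x \<noteq> y" "x \<notin> endpoints ps"
    and deg: "\<And>u. u \<in> V \<Longrightarrow> card {v \<in> V. {v, u} \<in> E} \<le> d"
  shows "card (V - insert y (endpoints ps)) * card (perms_into V E ((x, y) # ps)) \<le>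
    d * card (perms_into V E ps)"
proof -
  let ?Q = "V - insert y (endpoints ps)" and ?H = "perms_into V E ps"
  define D where "D \<psi> = {z \<in> V. {\<psi> z, \<psi> y} \<in> E}" for \<psi> :: "'a \<Rightarrow> 'a"
  define switch where "switch = (\<lambda>(\<phi> :: 'a \<Rightarrow> 'a, z). (\<phi> \<circ> Transposition.transpose x z, z))"
  have fin: "finite ?H" "finite (D \<psi>)" for \<psi>
    using V by (auto simp: D_def finite_perms_into)
  have card_D: "card (D \<psi>) \<le> d" if "\<psi> \<in> ?H" for \<psi>
    unfolding D_def using that
    by (intro card_permuted_neighbours_le[OF V xy(2) _ deg]) (auto simp: perms_into_def)
  have "inj_on switch (perms_into V E ((x, y) # ps) \<times> ?Q)"
  proof (rule inj_on_inverseI)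
    show "(\<lambda>(\<psi>, z). (\<psi> \<circ> Transposition.transpose x z, z)) (switch q) = q" for q
      by (cases q) (simp add: switch_def comp_assoc)
  qed
  moreover have "(\<phi> \<circ> Transposition.transpose x z, z) \<in> Sigma ?H D"
    if \<phi>: "\<phi> \<in> perms_into V E ((x, y) # ps)" and z: "z \<in> ?Q" for \<phi> z
  proof (intro SigmaI)
    show "\<phi> \<circ> Transposition.transpose x z \<in> ?H"
      using \<phi> z xy by (intro perms_into_transpose) (auto simp: perms_into_def)
    show "z \<in> D (\<phi> \<circ> Transposition.transpose x z)"
      using \<phi> z xy by (auto simp: D_def perms_into_def)
  qed
  then have "switch ` (perms_into V E ((x, y) # ps) \<times> ?Q) \<subseteq> Sigma ?H D"
    by (auto simp: switch_def)
  ultimately have "card (perms_into V E ((x, y) # ps) \<times> ?Q) \<le> card (Sigma ?H D)"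
    using fin by (intro card_inj_on_le[of switch]) auto
  also have "\<dots> = (\<Sum>\<psi>\<in>?H. card (D \<psi>))"
    using fin by (intro card_SigmaI) auto
  also have "\<dots> \<le> (\<Sum>\<psi>\<in>?H. d)"
    by (intro sum_mono card_D)
  finally show ?thesis
    by (simp add: card_cartesian_product mult.commute)
qed

lemma power_mult_fact_step_le:
  fixes n s t :: nat
  assumes "t \<le> n" "t = Suc s \<or> t = Suc (Suc s)"
  shows "n ^ Suc s * fact (n - s) \<le> n ^ t * fact (Suc (n - t))"
  using assms(2)
proof
  assume t: "t = Suc s"
  then have "n - s = Suc (n - t)"
    using assms(1) by simp
  then show ?thesis
    using t by simp
next
  assume t: "t = Suc (Suc s)"
  then have "n - s = Suc (Suc (n - t))"
    using assms(1) by simp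
  moreover have "fact (Suc (Suc (n - t))) \<le> n * fact (Suc (n - t))"
    unfolding fact_Suc[of "Suc (n - t)"] of_nat_id using assms(1) t by (intro mult_le_mono1) simp
  ultimately show ?thesis
    by (simp add: t del: fact_Suc)
qed

text \<open>
  Choosing the images component by component leaves at most \<open>n\<close> choices for each root and \<open>d\<close> for
  each further vertex. The number of roots is \<open>card (endpoints ps) - length ps\<close>.
\<close>

lemma card_perms_into_forest_le:
  assumes V: "finite V" and deg: "\<And>u. u \<in> V \<Longrightarrow> card {v \<in> V. {v, u} \<in> E} \<le> d"
    and "forest ps" "endpoints ps \<subseteq> V"
  shows "card (perms_into V E ps) * card V ^ length ps \<le>
    d ^ length ps * (card V ^ card (endpoints ps) * fact (card V - card (endpoints ps)))"
  using assms(3,4)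
proof (induction ps)
  case Nil
  have "perms_into V E [] = {\<phi>. \<phi> permutes V}"
    by (auto simp: perms_into_def)
  then show ?case
    using V by (simp add: card_permutations)
next
  case (Cons e ps)
  obtain x y where e: "e = (x, y)"
    by fastforce
  have xy: "x \<in> V" "y \<in> V" "x \<noteq> y" "x \<notin> endpoints ps" and ps: "forest ps" "endpoints ps \<subseteq> V"
    using Cons.prems by (auto simp: e)
  let ?n = "card V" and ?H = "perms_into V E (e # ps)" and ?t = "card (endpoints ps)"
  define t where "t = card (endpoints (e # ps))"
  have t: "t = Suc (card (insert y (endpoints ps)))" "t \<le> ?n"
    unfolding t_def using xy card_mono[OF V Cons.prems(2)] by (auto simp: e)
  have untouched: "card (V - insert y (endpoints ps)) = Suc (?n - t)"
    using t xy ps V by (subst card_Diff_subset) auto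
  have "Suc (?n - t) * (card ?H * ?n ^ length (e # ps)) =
      card (V - insert y (endpoints ps)) * card ?H * ?n ^ length ps * ?n"
    by (simp add: untouched algebra_simps)
  also have "\<dots> \<le> d * card (perms_into V E ps) * ?n ^ length ps * ?n"
    unfolding e by (intro mult_le_mono1 card_perms_into_Cons V xy deg)
  also have "\<dots> \<le> d * (d ^ length ps * (?n ^ ?t * fact (?n - ?t))) * ?n"
    using Cons.IH[OF ps] by (simp add: mult.assoc)
  also have "\<dots> = d ^ length (e # ps) * (?n ^ Suc ?t * fact (?n - ?t))"
    by (simp add: mult_ac)
  also have "?n ^ Suc ?t * fact (?n - ?t) \<le> ?n ^ t * fact (Suc (?n - t))"
    using t by (intro power_mult_fact_step_le) (auto simp: card_insert_if)
  finally have "Suc (?n - t) * (card ?H * ?n ^ length (e # ps)) \<le>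
      Suc (?n - t) * (d ^ length (e # ps) * (?n ^ t * fact (?n - t)))"
    by (simp add: mult_ac)
  then show ?case
    unfolding t_def by (metis Suc_mult_le_cancel1)
qed

lemma power_mult_fact_le: "real (k + t) ^ t * fact k \<le> 3 ^ t * fact (k + t)"
proof (induction t)
  case (Suc t)
  show ?case
  proof (cases "k + t = 0")
    case False
    define n where "n = k + t"
    have n: "0 < n" "t \<le> n"
      using False by (auto simp: n_def)
    have "(1 + 1 / real n) ^ t \<le> (1 + 1 / real n) ^ n"
      using n by (intro power_increasing) auto
    also have "\<dots> \<le> exp 1"
      using exp_ge_one_plus_x_over_n_power_n[of n 1] n by simp
    also have "\<dots> \<le> 3"
      by (rule exp_le)
    finally have ratio: "(1 + 1 / real n) ^ t \<le> 3" .
    have "real (Suc n) = real n * (1 + 1 / real n)"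
      using n by (simp add: field_simps)
    then have "real (Suc n) ^ t * fact k = (1 + 1 / real n) ^ t * (real n ^ t * fact k)"
      by (simp add: power_mult_distrib)
    also have "\<dots> \<le> 3 * (3 ^ t * fact n)"
      using mult_mono[OF ratio, of "real n ^ t * fact k" "3 ^ t * fact n"] Suc by (simp add: n_def)
    finally have "real (Suc n) * (real (Suc n) ^ t * fact k) \<le>
        real (Suc n) * (3 * (3 ^ t * fact n))"
      by (intro mult_left_mono) auto
    then show ?thesis
      by (simp add: n_def mult_ac)
  qed simp
qed simp

lemma card_perms_into_le:
  assumes V: "finite V" "V \<noteq> {}" and deg: "\<And>u. u \<in> V \<Longrightarrow> card {v \<in> V. {v, u} \<in> E} \<le> d"
    and ps: "forest ps" "endpoints ps \<subseteq> V"
  shows "real (card (perms_into V E ps)) \<le> (9 * real d / real (card V)) ^ length ps * fact (card V)"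
proof -
  let ?n = "card V" and ?t = "card (endpoints ps)" and ?m = "length ps"
  have n: "0 < ?n"
    using V by (simp add: card_gt_0_iff)
  have t: "?t \<le> ?n"
    using V ps by (intro card_mono)
  have "real (card (perms_into V E ps) * ?n ^ ?m) \<le> real (d ^ ?m * (?n ^ ?t * fact (?n - ?t)))"
    using card_perms_into_forest_le[OF V(1) deg ps] of_nat_le_iff by blast
  also have "\<dots> = real d ^ ?m * (real ?n ^ ?t * fact (?n - ?t))"
    by simp
  also have "\<dots> \<le> real d ^ ?m * (3 ^ ?t * fact ?n)"
    using power_mult_fact_le[of "?n - ?t" ?t] t by (simp add: mult_left_mono)
  also have "\<dots> \<le> real d ^ ?m * (3 ^ (2 * ?m) * fact ?n)"
    by (intro mult_left_mono mult_right_mono power_increasing card_endpoints_le) auto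
  also have "\<dots> = (9 * real d) ^ ?m * fact ?n"
    by (simp add: power_mult power_mult_distrib)
  finally show ?thesis
    using n by (simp add: field_simps)
qed

lemma card_perms_covering_le:
  assumes V: "finite V" and \<rho>: "\<rho> permutes V"
  shows "card {\<tau>. \<tau> permutes V \<and> (\<forall>(x, y)\<in>set ps. {\<rho> x, \<rho> y} \<in> image \<tau> ` E)} \<le>
    card (perms_into V E ps)"
proof (rule card_inj_on_le[of "\<lambda>\<tau>. inv \<tau> \<circ> \<rho>"])
  let ?A = "{\<tau>. \<tau> permutes V \<and> (\<forall>(x, y)\<in>set ps. {\<rho> x, \<rho> y} \<in> image \<tau> ` E)}"
  show "inj_on (\<lambda>\<tau>. inv \<tau> \<circ> \<rho>) ?A"
  proof (rule inj_on_inverseI)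
    fix \<tau> assume "\<tau> \<in> ?A"
    then have \<tau>: "bij \<tau>"
      by (auto intro: permutes_bij)
    show "\<rho> \<circ> inv (inv \<tau> \<circ> \<rho>) = \<tau>"
      using o_inv_distrib[OF bij_imp_bij_inv[OF \<tau>] permutes_bij[OF \<rho>]] permutes_inv_o(1)[OF \<rho>]
      by (simp add: inv_inv_eq[OF \<tau>] flip: comp_assoc)
  qed
  show "(\<lambda>\<tau>. inv \<tau> \<circ> \<rho>) ` ?A \<subseteq> perms_into V E ps"
  proof (rule image_subsetI)
    fix \<tau> assume "\<tau> \<in> ?A"
    then have \<tau>: "\<tau> permutes V" and E: "\<And>x y. (x, y) \<in> set ps \<Longrightarrow> {\<rho> x, \<rho> y} \<in> image \<tau> ` E"
      by auto
    have "{inv \<tau> (\<rho> x), inv \<tau> (\<rho> y)} \<in> E" if "(x, y) \<in> set ps" for x y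
    proof -
      from E[OF that] obtain e where e: "e \<in> E" "{\<rho> x, \<rho> y} = \<tau> ` e"
        by blast
      then have "inv \<tau> ` {\<rho> x, \<rho> y} = e"
        using image_inv_f_f[OF permutes_inj[OF \<tau>]] by metis
      then show ?thesis
        using e(1) by simp
    qed
    then show "inv \<tau> \<circ> \<rho> \<in> perms_into V E ps"
      using permutes_compose[OF \<rho> permutes_inv[OF \<tau>]] by (auto simp: perms_into_def)
  qed
qed (use V in \<open>rule finite_perms_into\<close>)

section \<open>Copies of the square of a Hamilton cycle\<close>

lemma finite_all_edges: "finite V \<Longrightarrow> finite (all_edges V)"
  by (rule finite_subset[of _ "Pow V"]) (auto simp: all_edges_def)

lemma image_all_edges_subset:
  assumes "inj_on f V" "f ` V \<subseteq> U"
  shows "image f ` all_edges V \<subseteq> all_edges U"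
  using assms by (auto simp: all_edges_def card_image inj_on_subset)

lemma image_all_edges:
  assumes "inj f"
  shows "image f ` all_edges V = all_edges (f ` V)"
proof
  show "image f ` all_edges V \<subseteq> all_edges (f ` V)"
    using assms by (intro image_all_edges_subset) (auto intro: inj_on_subset)
  show "all_edges (f ` V) \<subseteq> image f ` all_edges V"
  proof
    fix e assume e: "e \<in> all_edges (f ` V)"
    then obtain d where "d \<subseteq> V" "e = f ` d"
      by (auto simp: all_edges_def subset_image_iff)
    then show "e \<in> image f ` all_edges V"
      using e assms by (auto simp: all_edges_def card_image inj_on_subset)
  qed
qed

lemma card_Union_edges_le:
  assumes "finite F" "F \<subseteq> all_edges V"
  shows "card (\<Union>F) \<le> 2 * card F" "finite (\<Union>F)"
proof -
  have card: "card e = 2" if "e \<in> F" for e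
    using assms(2) that by (auto simp: all_edges_def)
  have "card (\<Union>F) \<le> sum card F"
    using assms(1) card by (intro card_Union_le_sum_card)
  then show "card (\<Union>F) \<le> 2 * card F"
    using card by simp
  show "finite (\<Union>F)"
    using assms(1) card by (intro finite_Union) (auto intro: card_ge_0_finite)
qed

text \<open>
  The edges of the square of the cycle on \<open>{..<n}\<close> are numbered by \<open>a < 2 * n\<close>: the edges with
  numbers \<open>2 * j\<close> and \<open>2 * j + 1\<close> join \<open>j\<close> to \<open>j - 1\<close> and \<open>j - 2\<close> modulo \<open>n\<close>. Those that wrap
  around have the numbers 0, 1 and 3. The edges from two consecutive vertices backwards have numbers
  differing by at most 3, so 3 is the gap allowed within a run.
\<close>

definition sq_edge :: "nat \<Rightarrow> nat \<Rightarrow> nat set" where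
  "sq_edge n a = {a div 2, (a div 2 + n - 1 - a mod 2) mod n}"

definition sq_edges :: "nat \<Rightarrow> nat set set" where
  "sq_edges n = sq_edge n ` {..<2 * n}"

definition sq_copy :: "nat \<Rightarrow> (nat \<Rightarrow> 'a) \<Rightarrow> 'a set set" where
  "sq_copy n c = image c ` sq_edges n"

lemma mod_less_double: "x < 2 * n \<Longrightarrow> x mod n = (if x < n then x else x - n)" for x n :: nat
  by (auto simp: le_mod_geq)

lemma sq_edge_double: "1 \<le> j \<Longrightarrow> j < n \<Longrightarrow> sq_edge n (2 * j) = {j, j - 1}"
  by (simp add: sq_edge_def mod_less_double)

lemma sq_edge_double_plus1: "2 \<le> j \<Longrightarrow> j < n \<Longrightarrow> sq_edge n (2 * j + 1) = {j, j - 2}"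
  by (simp add: sq_edge_def mod_less_double)

lemma sq_edges_Suc: "2 \<le> n \<Longrightarrow> i < n \<Longrightarrow> {i, Suc i mod n} \<in> sq_edges n"
  unfolding sq_edges_def
  by (intro image_eqI[of _ _ "2 * (Suc i mod n)"]) (auto simp: sq_edge_def mod_less_double)

lemma sq_edges_add2: "2 \<le> n \<Longrightarrow> i < n \<Longrightarrow> {i, (i + 2) mod n} \<in> sq_edges n"
  unfolding sq_edges_def
  by (intro image_eqI[of _ _ "2 * ((i + 2) mod n) + 1"]) (auto simp: sq_edge_def mod_less_double)

lemma sq_edges_subset_all_edges:
  assumes "3 \<le> n"
  shows "sq_edges n \<subseteq> all_edges {..<n}"
proof
  fix e assume "e \<in> sq_edges n"
  then obtain a where a: "a < 2 * n" "e = sq_edge n a"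
    by (auto simp: sq_edges_def)
  have "a mod 2 < 2" "a div 2 < n"
    using a(1) by auto
  then have "a div 2 \<noteq> (a div 2 + n - 1 - a mod 2) mod n"
    using assms by (auto simp: mod_less_double)
  then show "e \<in> all_edges {..<n}"
    using a by (auto simp: all_edges_def sq_edge_def)
qed

lemma finite_sq_edges: "finite (sq_edges n)"
  by (simp add: sq_edges_def)

lemma sq_copy_subset_all_edges:
  assumes "3 \<le> n" "inj_on c {..<n}" "c ` {..<n} \<subseteq> V"
  shows "sq_copy n c \<subseteq> all_edges V"
  unfolding sq_copy_def
  using sq_edges_subset_all_edges[OF assms(1)] image_all_edges_subset[OF assms(2,3)] by blast

lemma card_sq_edges_neighbours_le:
  assumes "3 \<le> n" "u < n"
  shows "card {v \<in> {..<n}. {v, u} \<in> sq_edges n} \<le> 4"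
proof -
  let ?N = "[(u + 1) mod n, (u + 2) mod n, (u + n - 1) mod n, (u + n - 2) mod n]"
  have "{v \<in> {..<n}. {v, u} \<in> sq_edges n} \<subseteq> set ?N"
  proof
    fix v assume "v \<in> {v \<in> {..<n}. {v, u} \<in> sq_edges n}"
    then obtain a where v: "v < n" and a: "a < 2 * n" "{v, u} = sq_edge n a"
      by (auto simp: sq_edges_def)
    define j r where "j = a div 2" and "r = a mod 2"
    have r: "r = 0 \<or> r = 1" and j: "j < n"
      using a(1) by (auto simp: j_def r_def)
    have "{v, u} = {j, (j + n - 1 - r) mod n}"
      using a(2) by (simp add: sq_edge_def j_def r_def)
    then consider "u = j" "v = (j + n - 1 - r) mod n" | "v = j" "u = (j + n - 1 - r) mod n"
      by (auto simp: doubleton_eq_iff)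
    then show "v \<in> set ?N"
    proof cases
      case 1
      then show ?thesis
        using r by (auto simp: numeral_2_eq_2)
    next
      case 2
      have "(u + (1 + r)) mod n = (j + n - 1 - r + (1 + r)) mod n"
        unfolding 2 by (rule mod_add_left_eq)
      also have "j + n - 1 - r + (1 + r) = j + n"
        using r assms(1) by auto
      finally have "(u + (1 + r)) mod n = v"
        using j 2 by simp
      then show ?thesis
        using r by auto
    qed
  qed
  then have "card {v \<in> {..<n}. {v, u} \<in> sq_edges n} \<le> card (set ?N)"
    by (intro card_mono) auto
  also have "\<dots> \<le> length ?N"
    by (rule card_length)
  finally show ?thesis
    by simp
qed

lemma graph_dist_le_enatE:
  assumes "graph_dist G u v \<le> enat k"
  obtains xs where "is_walk G xs" "hd xs = u" "last xs = v" "length xs \<le> Suc k"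
proof -
  have "\<not> enat (Suc k) \<le> graph_dist G u v"
    using assms by (metis Suc_ile_eq leD)
  then obtain xs where "is_walk G xs" "hd xs = u" "last xs = v"
    "\<not> enat (Suc k) \<le> enat (length xs - 1)"
    unfolding graph_dist_def by (auto simp: le_Inf_iff)
  then show thesis
    using that by auto
qed

lemma graph_dist_le_2_cases:
  assumes "graph_dist G u v \<le> 2" "u \<noteq> v"
  obtains "{u, v} \<in> edges G" | w where "{u, w} \<in> edges G" "{w, v} \<in> edges G"
proof -
  obtain xs where xs: "is_walk G xs" "hd xs = u" "last xs = v" "length xs \<le> 3"
    using graph_dist_le_enatE[of G u v 2] assms(1) by (auto simp: numeral_eq_enat)
  from xs(1) have "xs \<noteq> []"
    by (simp add: is_walk_def)
  then consider "length xs = 1" | "length xs = 2" | "length xs = 3"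
    using xs(4) length_0_conv[of xs] by linarith
  then show thesis
  proof cases
    case 1
    then show ?thesis
      using xs assms(2) by (auto simp: length_Suc_conv)
  next
    case 2
    then have "xs = [u, v]"
      using xs by (auto simp: length_Suc_conv numeral_2_eq_2)
    then have "{u, v} \<in> edges G"
      using xs(1) by (auto simp: is_walk_def)
    then show ?thesis
      by (rule that(1))
  next
    case 3
    then obtain w where "xs = [u, w, v]"
      using xs by (auto simp: length_Suc_conv numeral_3_eq_3)
    then have "{u, w} \<in> edges G" "{w, v} \<in> edges G"
      using xs(1) by (fastforce simp: is_walk_def nth_Cons split: nat.splits)+
    then show ?thesis
      by (rule that(2))
  qed
qed

definition cycle_edges :: "nat \<Rightarrow> (nat \<Rightarrow> 'a) \<Rightarrow> 'a set set" where
  "cycle_edges n c = {{c i, c (Suc i mod n)} | i. i < n}"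

lemma cycle_edges_neighbour:
  assumes c: "inj_on c {..<n}" and j: "j < n" and edge: "{u, c j} \<in> cycle_edges n c"
  shows "u = c (Suc j mod n) \<or> (\<exists>i<n. u = c i \<and> Suc i mod n = j)"
proof -
  obtain i where i: "i < n" "{u, c j} = {c i, c (Suc i mod n)}"
    using edge by (auto simp: cycle_edges_def)
  from i(2) consider "u = c i" "c j = c (Suc i mod n)" | "u = c (Suc i mod n)" "c j = c i"
    by (auto simp: doubleton_eq_iff)
  then show ?thesis
  proof cases
    case 1
    then show ?thesis
      using i(1) j inj_onD[OF c, of j "Suc i mod n"] by auto
  next
    case 2
    then show ?thesis
      using i(1) j inj_onD[OF c, of j i] by auto
  qed
qed

lemma cycle_edges_two_steps:
  assumes c: "inj_on c {..<n}" and edges: "{u, w} \<in> cycle_edges n c" "{w, v} \<in> cycle_edges n c"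
    and "u \<noteq> v"
  obtains i where "i < n" "{u, v} = {c i, c ((i + 2) mod n)}"
proof -
  from edges(1) obtain i where i: "i < n" "{u, w} = {c i, c (Suc i mod n)}"
    by (auto simp: cycle_edges_def)
  then have "w = c i \<or> w = c (Suc i mod n)"
    by (auto simp: doubleton_eq_iff)
  moreover have "Suc i mod n < n"
    using i(1) by simp
  ultimately obtain j where j: "j < n" "w = c j"
    using i(1) by blast
  have Suc_inj: "i = k" if "i < n" "k < n" "Suc i mod n = j" "Suc k mod n = j" for i k
    using that by (auto simp: mod_Suc split: if_splits)
  have "u = c (Suc j mod n) \<or> (\<exists>i<n. u = c i \<and> Suc i mod n = j)"
    using cycle_edges_neighbour[OF c j(1), of u] edges(1) j(2) by simp
  moreover have "v = c (Suc j mod n) \<or> (\<exists>i<n. v = c i \<and> Suc i mod n = j)"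
    using cycle_edges_neighbour[OF c j(1), of v] edges(2) j(2) by (simp add: insert_commute)
  ultimately obtain i where "i < n" "Suc i mod n = j" "{u, v} = {c i, c (Suc j mod n)}"
    using \<open>u \<noteq> v\<close> Suc_inj by blast
  then show thesis
    using that by (auto simp: mod_Suc_eq)
qed

lemma contains_ham_cycle_square_if_sq_copy:
  assumes n: "3 \<le> n" and c: "bij_betw c {..<n} V" and W: "sq_copy n c \<subseteq> W"
  shows "contains_ham_cycle_square (Graph V W)"
proof -
  define C where "C = Graph V (cycle_edges n c)"
  have card_V: "card V = n"
    using bij_betw_same_card[OF c] by simp
  have in_W: "{c i, c j} \<in> W" if "{i, j} \<in> sq_edges n" for i j
    using W that by (auto simp: sq_copy_def)
  have "{u, v} \<in> W" if uv: "u \<noteq> v" "graph_dist C u v \<le> 2" for u v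
    using uv(2,1)
  proof (cases rule: graph_dist_le_2_cases)
    case 1
    then obtain i where "i < n" "{u, v} = {c i, c (Suc i mod n)}"
      by (auto simp: C_def cycle_edges_def)
    then show ?thesis
      using n by (simp add: in_W sq_edges_Suc)
  next
    case (2 w)
    then have "{u, w} \<in> cycle_edges n c" "{w, v} \<in> cycle_edges n c"
      by (simp_all add: C_def)
    then obtain i where "i < n" "{u, v} = {c i, c ((i + 2) mod n)}"
      using cycle_edges_two_steps[OF bij_betw_imp_inj_on[OF c]] uv(1) by metis
    then show ?thesis
      using n by (simp add: in_W sq_edges_add2 del: add_2_eq_Suc')
  qed
  then have "edges (graph_square C) \<subseteq> W"
    by (auto simp: graph_square_def)
  moreover have "is_cycle C"
    unfolding is_cycle_def using n c by (auto simp: C_def cycle_edges_def card_V)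
  ultimately show ?thesis
    unfolding contains_ham_cycle_square_def subgraph_def
    by (intro exI[of _ C]) (auto simp: C_def graph_square_def)
qed

section \<open>Copies containing given edges\<close>

text \<open>
  Scan the vertices from left to right and join each one that has an edge backwards to one of its
  two predecessors. This gives at least half as many tree edges as edges. There is a surplus at the
  first such vertex \<open>j\<close> of a run: either it has a single backward edge, or both its backward edges
  can be kept since \<open>j - 1\<close> is still isolated.
\<close>

fun backward_forest :: "nat set \<Rightarrow> nat \<Rightarrow> (nat \<times> nat) list" where
  "backward_forest J 0 = []"
| "backward_forest J (Suc j) =
    (if 2 * j \<in> J \<and> 2 * j + 1 \<in> J \<and> 2 * (j - 1) \<notin> J \<and> 2 * (j - 1) + 1 \<notin> J
     then (j - 1, j) # (j, j - 2) # backward_forest J j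
     else if 2 * j \<in> J then (j, j - 1) # backward_forest J j
     else if 2 * j + 1 \<in> J then (j, j - 2) # backward_forest J j
     else backward_forest J j)"

lemma endpoints_backward_forest: "endpoints (backward_forest J j) \<subseteq> {..<j}"
  by (induction j) auto

lemma isolated_backward_forest:
  assumes "2 * j \<notin> J" "2 * j + 1 \<notin> J"
  shows "j \<notin> endpoints (backward_forest J (Suc j))"
  using assms endpoints_backward_forest[of J j] by auto

lemma no_wrap_positive:
  fixes j :: nat
  assumes "{0, 1, 3} \<inter> J = {}"
  shows "2 * j \<in> J \<Longrightarrow> 1 \<le> j" "2 * j + 1 \<in> J \<Longrightarrow> 2 \<le> j"
proof -
  show "1 \<le> j" if "2 * j \<in> J"
    using assms that by (cases j) auto
  show "2 \<le> j" if "2 * j + 1 \<in> J"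
  proof (rule ccontr)
    assume "\<not> 2 \<le> j"
    then consider "j = 0" | "j = 1"
      by linarith
    then show False
      using assms that by cases auto
  qed
qed

lemma forest_backward_forest:
  assumes "{0, 1, 3} \<inter> J = {}"
  shows "forest (backward_forest J j)"
proof (induction j)
  case (Suc j)
  have "j \<notin> endpoints (backward_forest J j)"
    using endpoints_backward_forest[of J j] by auto
  moreover have "j - 1 \<notin> endpoints (backward_forest J j)"
    if "1 \<le> j" "2 * (j - 1) \<notin> J" "2 * (j - 1) + 1 \<notin> J"
    using isolated_backward_forest[OF that(2,3)] that(1) by simp
  ultimately show ?case
    using Suc.IH no_wrap_positive[OF assms, of j] by (auto simp del: mult_Suc_right)
qed simp

lemma backward_forest_edges:
  assumes "{0, 1, 3} \<inter> J = {}" "j \<le> n" "(x, y) \<in> set (backward_forest J j)"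
  shows "{x, y} \<in> sq_edge n ` J"
  using assms(2,3)
proof (induction j)
  case (Suc j)
  have "{j, j - 1} \<in> sq_edge n ` J" if "2 * j \<in> J"
    using sq_edge_double[OF no_wrap_positive(1)[OF assms(1) that], of n] that Suc.prems(1)
    by (intro image_eqI[of _ _ "2 * j"]) auto
  moreover have "{j, j - 2} \<in> sq_edge n ` J" if "2 * j + 1 \<in> J"
    using sq_edge_double_plus1[OF no_wrap_positive(2)[OF assms(1) that], of n] that Suc.prems(1)
    by (intro image_eqI[of _ _ "2 * j + 1"]) auto
  ultimately show ?case
    using Suc by (auto simp: insert_commute split: if_splits)
qed simp

lemma card_Int_lessThan_Suc: "card (A \<inter> {..<Suc m}) = card (A \<inter> {..<m}) + of_bool (m \<in> A)"
  by (simp add: lessThan_Suc Int_insert_right)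

lemma length_backward_forest_ge:
  assumes "{0, 1, 3} \<inter> J = {}"
  shows "card (J \<inter> {..<2 * j}) + card (run_starts 3 J \<inter> {..<2 * j}) \<le>
    2 * length (backward_forest J j)"
proof (induction j)
  case (Suc j)
  have "2 * j + 1 \<notin> run_starts 3 J" if "2 * j \<in> J"
    using that by (force simp: run_starts_def)
  moreover have "2 * j \<notin> run_starts 3 J" if "2 * (j - 1) \<in> J \<or> 2 * (j - 1) + 1 \<in> J" "2 * j \<in> J"
    using no_wrap_positive(1)[OF assms that(2)] that(1) by (force simp: run_starts_def)
  ultimately have "of_bool (2 * j \<in> J) + of_bool (2 * j + 1 \<in> J) +
      (of_bool (2 * j \<in> run_starts 3 J) + of_bool (2 * j + 1 \<in> run_starts 3 J)) +
      2 * length (backward_forest J j) \<le> 2 * length (backward_forest J (Suc j))"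
    using run_starts_subset[of 3 J] by (auto simp: of_bool_def subset_eq)
  then show ?case
    using Suc.IH card_Int_lessThan_Suc[of J "2 * j"] card_Int_lessThan_Suc[of J "2 * j + 1"]
      card_Int_lessThan_Suc[of "run_starts 3 J" "2 * j"]
      card_Int_lessThan_Suc[of "run_starts 3 J" "2 * j + 1"]
    by (simp del: backward_forest.simps)
qed simp

abbreviation perms :: "nat \<Rightarrow> (nat \<Rightarrow> nat) set" where
  "perms n \<equiv> {\<tau>. \<tau> permutes {..<n}}"

lemma codegree_sq_copy_le_power:
  assumes \<rho>: "\<rho> \<in> perms n" and n: "3 \<le> n" and ps: "forest ps" "endpoints ps \<subseteq> {..<n}"
    and F: "\<And>x y. (x, y) \<in> set ps \<Longrightarrow> {x, y} \<in> F"
  shows "codegree (sq_copy n) (perms n) (image \<rho> ` F) \<le> (36 / real n) ^ length ps * fact n"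
proof -
  have "codegree (sq_copy n) (perms n) (image \<rho> ` F) \<le>
      card {\<tau>. \<tau> permutes {..<n} \<and> (\<forall>(x, y)\<in>set ps. {\<rho> x, \<rho> y} \<in> image \<tau> ` sq_edges n)}"
    unfolding codegree_def
  proof (rule card_mono)
    have "{\<rho> x, \<rho> y} \<in> image \<rho> ` F" if "(x, y) \<in> set ps" for x y
      using F[OF that] by (intro image_eqI[of _ _ "{x, y}"]) auto
    then show "{\<tau> \<in> perms n. image \<rho> ` F \<subseteq> sq_copy n \<tau>} \<subseteq>
        {\<tau>. \<tau> permutes {..<n} \<and> (\<forall>(x, y)\<in>set ps. {\<rho> x, \<rho> y} \<in> image \<tau> ` sq_edges n)}"
      by (fastforce simp: sq_copy_def)
  qed (simp add: finite_permutations)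
  also have "\<dots> \<le> card (perms_into {..<n} (sq_edges n) ps)"
    using \<rho> by (intro card_perms_covering_le) auto
  finally have "real (codegree (sq_copy n) (perms n) (image \<rho> ` F)) \<le>
      card (perms_into {..<n} (sq_edges n) ps)"
    by simp
  also have "\<dots> \<le> (9 * real 4 / real (card {..<n})) ^ length ps * fact (card {..<n})"
    using n ps
    by (intro card_perms_into_le card_sq_edges_neighbours_le) (auto simp: lessThan_empty_iff)
  finally show ?thesis
    by simp
qed

lemma codegree_sq_copy_le:
  assumes \<rho>: "\<rho> \<in> perms n" and n: "36 \<le> n" and J: "J \<subseteq> {..<2 * n} - {0, 1, 3}"
  shows "codegree (sq_copy n) (perms n) (image \<rho> ` sq_edge n ` J) \<le>
    fact n * run_weight 3 (36 / sqrt n) (1 / sqrt n) J"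
proof -
  let ?ps = "backward_forest J n"
  have no_wrap: "{0, 1, 3} \<inter> J = {}" and fin: "finite J"
    using J finite_subset by auto
  have "J \<inter> {..<2 * n} = J" "run_starts 3 J \<inter> {..<2 * n} = run_starts 3 J"
    using J run_starts_subset[of 3 J] by auto
  then have "card J + card (run_starts 3 J) \<le> 2 * length ?ps"
    using length_backward_forest_ge[OF no_wrap, of n] by simp
  then have "(36 / real n) ^ length ?ps \<le> run_weight 3 (36 / sqrt n) (1 / sqrt n) J"
    using n fin by (intro power_le_run_weight) auto
  then have "(36 / real n) ^ length ?ps * fact n \<le>
      fact n * run_weight 3 (36 / sqrt n) (1 / sqrt n) J"
    by (simp add: mult.commute)
  moreover have "codegree (sq_copy n) (perms n) (image \<rho> ` sq_edge n ` J) \<le>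
      (36 / real n) ^ length ?ps * fact n"
    using n by (intro codegree_sq_copy_le_power \<rho> forest_backward_forest no_wrap
        endpoints_backward_forest backward_forest_edges[OF no_wrap order_refl]) auto
  ultimately show ?thesis
    by linarith
qed

text \<open>Deleting the three edges that wrap around costs a factor of at most \<open>n\<^sup>3\<close>.\<close>

lemma codegree_sq_copy_wrap_le:
  assumes \<rho>: "\<rho> \<in> perms n" and n: "1296 \<le> n" and J: "J \<subseteq> {..<2 * n}"
  shows "codegree (sq_copy n) (perms n) (image \<rho> ` sq_edge n ` J) \<le>
    fact n * real n ^ 3 * run_weight 3 (36 / sqrt n) (1 / sqrt n) J"
proof -
  let ?l = "36 / sqrt n" and ?m = "1 / sqrt n" and ?D = "{0, 1, 3 :: nat}"
  have sqrt_n: "36 \<le> sqrt n"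
    using n by (intro real_le_rsqrt) simp
  have "finite J"
    using J finite_subset by blast
  have "real (codegree (sq_copy n) (perms n) (image \<rho> ` sq_edge n ` J)) \<le>
      codegree (sq_copy n) (perms n) (image \<rho> ` sq_edge n ` (J - ?D))"
    by (intro of_nat_mono codegree_antimono) (auto simp: finite_permutations)
  also have "\<dots> \<le> fact n * run_weight 3 ?l ?m (J - ?D)"
    using J n by (intro codegree_sq_copy_le \<rho>) auto
  also have "\<dots> \<le> fact n * (real n ^ 3 * run_weight 3 ?l ?m J)"
  proof (intro mult_left_mono)
    have "(?l * ?m) ^ card ?D * run_weight 3 ?l ?m (J - ?D) \<le> run_weight 3 ?l ?m J"
      using n sqrt_n \<open>finite J\<close> by (intro run_weight_Diff_le) (auto simp: divide_le_eq)
    moreover have "?l * ?m = 36 / real n"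
      by simp
    ultimately have "36 ^ 3 * run_weight 3 ?l ?m (J - ?D) \<le> real n ^ 3 * run_weight 3 ?l ?m J"
      using n by (simp add: power_divide pos_divide_le_eq power3_eq_cube mult.commute)
    moreover have "0 \<le> run_weight 3 ?l ?m (J - ?D)"
      by (simp add: run_weight_nonneg)
    ultimately show "run_weight 3 ?l ?m (J - ?D) \<le> real n ^ 3 * run_weight 3 ?l ?m J"
      by simp
  qed simp
  finally show ?thesis
    by (simp add: mult.assoc)
qed

definition rotation :: "nat \<Rightarrow> nat \<Rightarrow> nat \<Rightarrow> nat" where
  "rotation n s i = (if i < n then (i + s) mod n else i)"

lemma permutes_rotation:
  assumes "s < n"
  shows "rotation n s permutes {..<n}"
proof (rule bij_imp_permutes)
  show "bij_betw (rotation n s) {..<n} {..<n}"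
    using assms by (intro bij_betwI[of _ _ _ "\<lambda>i. (i + n - s) mod n"])
      (auto simp: rotation_def mod_less_double)
qed (simp add: rotation_def)

lemma sq_edge_eq_rotation_image:
  assumes n: "3 \<le> n" "s < n" and a: "a < 2 * n"
    and cut: "s \<notin> sq_edge n a" "(s + n - 1) mod n \<notin> sq_edge n a"
  obtains b where "b \<in> {..<2 * n} - {0, 1, 3}" "sq_edge n a = rotation n s ` sq_edge n b"
proof
  define j r where "j = a div 2" and "r = a mod 2"
  define i where "i = (j + n - s) mod n"
  have r: "r = 0 \<or> r = 1" and j: "j < n" and i: "i < n"
    using a n by (auto simp: j_def r_def i_def)
  have ij: "(i + s) mod n = j"
    using n(2) j by (auto simp: i_def mod_less_double)
  have ends: "j \<noteq> s" "(j + n - 1 - r) mod n \<noteq> (s + n - 1) mod n"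
    using cut by (auto simp: sq_edge_def j_def r_def)
  have "i \<noteq> 0"
    using ij ends(1) n(2) by (cases "i = 0") auto
  moreover have "\<not> (i = 1 \<and> r = 1)"
    using ends(2) j n ij by (auto simp: mod_less_double split: if_splits)
  ultimately show "2 * i + r \<in> {..<2 * n} - {0, 1, 3}"
    using i r by (auto, presburger)
  have "((i + n - 1 - r) mod n + s) mod n = (j + n - 1 - r) mod n"
    unfolding ij[symmetric] using n i r by (auto simp: mod_less_double split: if_splits)
  moreover have "(2 * i + r) div 2 = i" "r mod 2 = r"
    using r by auto
  ultimately show "sq_edge n a = rotation n s ` sq_edge n (2 * i + r)"
    using i ij by (simp add: sq_edge_def rotation_def flip: j_def r_def)
qed

lemma ex_cut_avoiding:
  assumes "finite U" "2 * card U < n"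
  obtains s where "s < n" "s \<notin> U" "(s + n - 1) mod n \<notin> U"
proof -
  let ?A = "{..<n} \<inter> U" and ?B = "{s \<in> {..<n}. (s + n - 1) mod n \<in> U}"
  have "card ?A \<le> card U"
    using assms(1) by (intro card_mono) auto
  moreover have "card ?B \<le> card U"
    using assms by (intro card_inj_on_le[of "\<lambda>s. (s + n - 1) mod n"])
      (auto simp: inj_on_def mod_less_double split: if_splits)
  ultimately have "card (?A \<union> ?B) < card {..<n}"
    using card_Un_le[of ?A ?B] assms(2) by simp
  moreover have "finite (?A \<union> ?B)"
    by simp
  ultimately have "\<not> {..<n} \<subseteq> ?A \<union> ?B"
    using card_mono[of "?A \<union> ?B" "{..<n}"] by linarith
  then show thesis
    using that by blast
qed

text \<open>
  A small set of edges leaves two consecutive vertices of the cycle uncovered. A rotated labelling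
  that cuts the cycle between them represents it without wrapping around.
\<close>

lemma sq_copy_unwrap:
  assumes n: "3 \<le> n" and \<rho>: "\<rho> \<in> perms n" and T: "T \<subseteq> sq_copy n \<rho>" "4 * card T < n"
  obtains \<rho>' where "\<rho>' \<in> perms n" "T \<subseteq> image \<rho>' ` sq_edge n ` ({..<2 * n} - {0, 1, 3})"
proof -
  obtain F where F: "F \<subseteq> sq_edges n" "inj_on (image \<rho>) F" "T = image \<rho> ` F"
    using T(1) unfolding sq_copy_def subset_image_inj by blast
  have fin: "finite F"
    using F(1) finite_sq_edges finite_subset by blast
  have "card F = card T"
    using F(2,3) by (simp add: card_image)
  then have "2 * card (\<Union>F) < n" "finite (\<Union>F)"
    using card_Union_edges_le[OF fin order_trans[OF F(1) sq_edges_subset_all_edges[OF n]]] T(2)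
    by auto
  then obtain s where s: "s < n" "s \<notin> \<Union>F" "(s + n - 1) mod n \<notin> \<Union>F"
    using ex_cut_avoiding by blast
  have "e \<in> image (rotation n s) ` sq_edge n ` ({..<2 * n} - {0, 1, 3})" if e: "e \<in> F" for e
  proof -
    obtain a where a: "a < 2 * n" "e = sq_edge n a"
      using F(1) e by (auto simp: sq_edges_def)
    obtain b where "b \<in> {..<2 * n} - {0, 1, 3}" "sq_edge n a = rotation n s ` sq_edge n b"
      using sq_edge_eq_rotation_image[OF n s(1) a(1)] s(2,3) e a(2) by blast
    then show ?thesis
      using a(2) by blast
  qed
  then have "image \<rho> ` F \<subseteq> image \<rho> ` image (rotation n s) ` sq_edge n ` ({..<2 * n} - {0, 1, 3})"
    by (intro image_mono subsetI)
  then have "T \<subseteq> image (\<rho> \<circ> rotation n s) ` sq_edge n ` ({..<2 * n} - {0, 1, 3})"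
    by (simp add: F(3) image_image comp_def)
  moreover have "\<rho> \<circ> rotation n s \<in> perms n"
    using permutes_compose[OF permutes_rotation[OF s(1)]] \<rho> by simp
  ultimately show thesis
    using that by blast
qed

section \<open>Spreadness of the squared cycles\<close>

text \<open>
  Dividing the weight \<open>36 / sqrt n\<close> of an edge by the edge probability \<open>864 / sqrt n\<close> gives \<open>1 / 24\<close>.
  This is small enough for the sum over all runs to stay below \<open>2 ^ sqrt n\<close>.
\<close>

lemma power_half_le_exp: "(1 / 2) ^ k \<le> exp (- real k / 2)"
proof -
  have "exp (1 / 2) \<le> (2 :: real)"
    using exp_bound_lemma[of "1 / 2 :: real"] by simp
  then have "1 / 2 \<le> exp (- 1 / 2 :: real)"
    by (simp add: exp_minus field_simps)
  then have "(1 / 2) ^ k \<le> exp (- 1 / 2 :: real) ^ k"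
    by (intro power_mono) auto
  then show ?thesis
    by (simp flip: exp_of_nat_mult)
qed

lemma spread_sum_sq_copy_le:
  assumes \<rho>: "\<rho> \<in> perms n" and n: "1296 \<le> n" and k: "sqrt n \<le> k"
  shows "spread_sum (864 / sqrt n) (sq_copy n) (perms n) k (sq_copy n \<rho>) \<le>
    real n ^ 3 * exp (- sqrt n / 6) * fact n"
proof -
  let ?m = "1 / sqrt n" and ?A = "{..<2 * n}"
  have sq_copy: "sq_copy n \<rho> = (\<lambda>a. \<rho> ` sq_edge n a) ` ?A"
    by (simp add: sq_copy_def sq_edges_def image_image)
  have "36 / sqrt n / (864 / sqrt n) = 1 / 24"
    using n by (simp add: field_simps)
  moreover have "spread_sum (864 / sqrt n) (sq_copy n) (perms n) k (sq_copy n \<rho>) \<le>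
      fact n * real n ^ 3 *
      (\<Sum>J | J \<subseteq> ?A \<and> k \<le> card J. run_weight 3 (36 / sqrt n / (864 / sqrt n)) ?m J)"
    unfolding sq_copy using codegree_sq_copy_wrap_le[OF \<rho> n] n
    by (intro spread_sum_image_le) (auto simp: image_image)
  ultimately have "spread_sum (864 / sqrt n) (sq_copy n) (perms n) k (sq_copy n \<rho>) \<le>
      fact n * real n ^ 3 * (\<Sum>J | J \<subseteq> ?A \<and> k \<le> card J. run_weight 3 (1 / 24) ?m J)"
    by simp
  also have "\<dots> \<le> fact n * real n ^ 3 * ((1 / 2) ^ k * exp (4 * (1 / 24) * ?m * card ?A))"
    by (intro mult_left_mono sum_large_run_weight_le) auto
  also have "\<dots> \<le> fact n * real n ^ 3 * (exp (- sqrt n / 2) * exp (sqrt n / 3))"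
  proof (intro mult_left_mono mult_mono)
    have "(1 / 2) ^ k \<le> exp (- real k / 2)"
      by (rule power_half_le_exp)
    also have "\<dots> \<le> exp (- sqrt n / 2)"
      using k by simp
    finally show "(1 / 2) ^ k \<le> exp (- sqrt n / 2)" .
    have "4 * (1 / 24) * ?m * card ?A = sqrt n / 3"
      by (simp add: field_simps real_div_sqrt)
    then show "exp (4 * (1 / 24) * ?m * card ?A) \<le> exp (sqrt n / 3)"
      by simp
  qed auto
  also have "exp (- sqrt n / 2) * exp (sqrt n / 3) = exp (- sqrt n / 6)"
    by (simp flip: exp_add)
  finally show ?thesis
    by (simp add: mult_ac)
qed

lemma spread_sum_small_subset_le:
  assumes \<rho>: "\<rho> \<in> perms n" and n: "1296 \<le> n" and K: "216 \<le> K"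
    and T: "T \<subseteq> sq_copy n \<rho>" "card T \<le> sqrt n"
  shows "spread_sum (K / sqrt n) (sq_copy n) (perms n) 1 T \<le> 144 / K * fact n"
proof -
  let ?m = "1 / sqrt n"
  have "4 < sqrt n"
    using n by (intro real_less_rsqrt) simp
  then have "4 * sqrt n < sqrt n * sqrt n"
    using n by (intro mult_strict_right_mono) auto
  then have "4 * real (card T) < n"
    using T(2) by simp
  then have "4 * card T < n"
    by linarith
  then obtain \<sigma> where \<sigma>: "\<sigma> \<in> perms n" "T \<subseteq> image \<sigma> ` sq_edge n ` ({..<2 * n} - {0, 1, 3})"
    using sq_copy_unwrap[OF _ \<rho> T(1)] n by force
  then have "T \<subseteq> (\<lambda>a. \<sigma> ` sq_edge n a) ` ({..<2 * n} - {0, 1, 3})"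
    by (simp add: image_image)
  then obtain A where A: "A \<subseteq> {..<2 * n} - {0, 1, 3}" "inj_on (\<lambda>a. \<sigma> ` sq_edge n a) A"
    "T = (\<lambda>a. \<sigma> ` sq_edge n a) ` A"
    unfolding subset_image_inj by blast
  have fin: "finite A"
    using A(1) finite_subset by blast
  have card_A: "card A = card T"
    using A by (simp add: card_image)
  have "spread_sum (K / sqrt n) (sq_copy n) (perms n) 1 T \<le>
      fact n * (\<Sum>J | J \<subseteq> A \<and> 1 \<le> card J. run_weight 3 (36 / sqrt n / (K / sqrt n)) ?m J)"
    unfolding A(3) using codegree_sq_copy_le[OF \<sigma>(1)] A(1) n K fin
    by (intro spread_sum_image_le) (auto simp: image_image)
  also have "36 / sqrt n / (K / sqrt n) = 36 / K"
    using n K by (simp add: field_simps)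
  also have "(\<Sum>J | J \<subseteq> A \<and> 1 \<le> card J. run_weight 3 (36 / K) ?m J) \<le>
      exp (2 * (36 / K) * ?m * card A) - 1"
    using fin K by (intro sum_nonempty_run_weight_le) auto
  also have "\<dots> \<le> exp (72 / K) - 1"
    using T(2) n K by (simp add: card_A field_simps)
  also have "\<dots> \<le> 144 / K"
    using exp_bound_lemma[of "72 / K"] K by simp
  finally show ?thesis
    by (simp add: mult_ac)
qed

section \<open>The binomial random graph\<close>

lemma gnp_eq_map_bernoulli_subset_pmf:
  "gnp n p = map_pmf (\<lambda>W. Graph {1..n} (image Suc ` W)) (bernoulli_subset_pmf p (all_edges {..<n}))"
proof -
  have "all_edges {1..n} = image Suc ` all_edges {..<n}"
    by (simp add: image_all_edges image_Suc_lessThan)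
  moreover have "inj (image Suc)"
    by (simp add: inj_def inj_image_eq_iff)
  ultimately have "bernoulli_subset_pmf p (all_edges {1..n}) =
      map_pmf (image (image Suc)) (bernoulli_subset_pmf p (all_edges {..<n}))"
    by (simp add: map_image_bernoulli_subset_pmf finite_all_edges)
  moreover have "gnp n p = map_pmf (Graph {1..n}) (bernoulli_subset_pmf p (all_edges {1..n}))"
    by (simp add: gnp_def bernoulli_subset_pmf_def map_pmf_comp)
  ultimately show ?thesis
    by (simp add: map_pmf_comp)
qed

lemma contains_ham_cycle_square_if_perm:
  assumes "3 \<le> n" "\<tau> \<in> perms n" "sq_copy n \<tau> \<subseteq> W"
  shows "contains_ham_cycle_square (Graph {1..n} (image Suc ` W))"
proof (rule contains_ham_cycle_square_if_sq_copy)
  have "bij_betw Suc {..<n} {1..n}"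
    by (simp add: bij_betw_def image_Suc_lessThan)
  then show "bij_betw (Suc \<circ> \<tau>) {..<n} {1..n}"
    using assms(2) permutes_imp_bij by (intro bij_betw_trans) auto
  show "sq_copy n (Suc \<circ> \<tau>) \<subseteq> image Suc ` W"
    using assms(3) by (auto simp: sq_copy_def image_comp[of Suc, symmetric] simp del: o_apply)
qed (rule assms(1))

lemma two_round_splitE:
  fixes p q s :: real
  assumes "0 < s" "0 < q" "s + q \<le> p" "p \<le> 1"
  obtains r where "s \<le> r" "r \<le> 1" "1 - p = (1 - r) * (1 - q)"
proof
  let ?r = "(p - q) / (1 - q)"
  have q: "0 < 1 - q"
    using assms by linarith
  show "1 - p = (1 - ?r) * (1 - q)"
    using q by (simp add: field_simps)
  show "?r \<le> 1"
    using q assms by simp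
  have "s * (1 - q) \<le> s"
    using assms by (simp add: mult_left_le)
  then have "s * (1 - q) \<le> p - q"
    using assms by linarith
  then show "s \<le> ?r"
    using q by (simp add: pos_le_divide_eq)
qed

lemma prob_bernoulli_subset_contains_sq_copy_ge:
  assumes K: "216 \<le> K" and n: "1296 \<le> n" and p: "(864 + K) / sqrt n \<le> p" "p \<le> 1"
  shows "1 - 2 * (real n ^ 3 * exp (- sqrt n / 6)) - 288 / K \<le>
    measure_pmf.prob (bernoulli_subset_pmf p (all_edges {..<n})) {W. \<exists>\<tau>\<in>perms n. sq_copy n \<tau> \<subseteq> W}"
proof -
  let ?q = "K / sqrt n" and ?k = "nat \<lceil>sqrt n\<rceil>"
  obtain r where r: "864 / sqrt n \<le> r" "r \<le> 1" "1 - p = (1 - r) * (1 - ?q)"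
    using two_round_splitE[of "864 / sqrt n" ?q p] K n p by (auto simp: add_divide_distrib)
  have pos: "0 < 864 / sqrt n"
    using n by simp
  have card_perms: "card (perms n) = fact n"
    by (simp add: card_permutations)
  have "1 - 2 * (real n ^ 3 * exp (- sqrt n / 6)) - 2 * (144 / K) \<le>
    measure_pmf.prob (bernoulli_subset_pmf p (all_edges {..<n})) {W. \<exists>\<tau>\<in>perms n. sq_copy n \<tau> \<subseteq> W}"
  proof (rule prob_contains_member_ge)
    show "sq_copy n \<tau> \<subseteq> all_edges {..<n}" if "\<tau> \<in> perms n" for \<tau>
      using that n permutes_image[of \<tau> "{..<n}"]
      by (intro sq_copy_subset_all_edges) (auto intro: permutes_inj_on)
    show "spread_sum r (sq_copy n) (perms n) ?k (sq_copy n \<tau>) \<le>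
        real n ^ 3 * exp (- sqrt n / 6) * card (perms n)" if "\<tau> \<in> perms n" for \<tau>
      using order_trans[OF spread_sum_antimono[OF pos r(1)]
          spread_sum_sq_copy_le[OF that n real_nat_ceiling_ge]]
      by (simp add: card_perms)
    show "spread_sum ?q (sq_copy n) (perms n) 1 T \<le> 144 / K * card (perms n)"
      if "\<tau> \<in> perms n" "T \<subseteq> sq_copy n \<tau>" "card T < ?k" for \<tau> T
    proof -
      have "card T \<le> sqrt n"
        using that(3) by linarith
      then show ?thesis
        using spread_sum_small_subset_le[OF that(1) n K that(2)] by (simp add: card_perms)
    qed
    show "perms n \<noteq> {}"
      using permutes_id[of "{..<n}"] by blast
    show "0 < r"
      using pos r(1) by linarith
    show "?q \<le> 1"
      using p pos unfolding add_divide_distrib by linarith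
  qed (use K n r in \<open>auto simp: finite_all_edges finite_permutations\<close>)
  then show ?thesis
    by simp
qed

lemma prob_gnp_contains_ham_cycle_square_ge:
  assumes K: "216 \<le> K" and n: "1296 \<le> n" and p: "(864 + K) / sqrt n \<le> p" "p \<le> 1"
  shows "1 - 2 * (real n ^ 3 * exp (- sqrt n / 6)) - 288 / K \<le>
    measure_pmf.prob (gnp n p) {G. contains_ham_cycle_square G}"
proof -
  let ?M = "bernoulli_subset_pmf p (all_edges {..<n})"
  have "1 - 2 * (real n ^ 3 * exp (- sqrt n / 6)) - 288 / K \<le>
      measure_pmf.prob ?M {W. \<exists>\<tau>\<in>perms n. sq_copy n \<tau> \<subseteq> W}"
    by (rule prob_bernoulli_subset_contains_sq_copy_ge[OF assms])
  also have "\<dots> \<le> measure_pmf.prob (gnp n p) {G. contains_ham_cycle_square G}"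
    unfolding gnp_eq_map_bernoulli_subset_pmf measure_map_pmf
    using n contains_ham_cycle_square_if_perm
    by (intro measure_pmf.finite_measure_mono) auto
  finally show ?thesis .
qed

theorem theorem1p2:
  fixes \<epsilon> :: real
  assumes "\<epsilon> > 0"
  shows "\<exists>K::real. K > 0 \<and>
           (\<forall>\<^sub>F n :: nat in sequentially. \<forall>p::real. 0 \<le> p \<and> p \<le> 1 \<and> p \<ge> K / sqrt (real n) \<longrightarrow>
              measure_pmf.prob (gnp n p) {G. contains_ham_cycle_square G} \<ge> 1 - \<epsilon>)"
proof -
  define K where "K = 216 + 576 / \<epsilon>"
  have K: "216 \<le> K" "288 / K \<le> \<epsilon> / 2"
    using assms by (simp_all add: K_def field_simps)
  have "(\<lambda>n::nat. 2 * (real n ^ 3 * exp (- sqrt n / 6))) \<longlonglongrightarrow> 0"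
    by real_asymp
  then have "\<forall>\<^sub>F n::nat in sequentially. 2 * (real n ^ 3 * exp (- sqrt n / 6)) < \<epsilon> / 2"
    by (rule order_tendstoD(2)) (use assms in simp)
  then have "\<forall>\<^sub>F n::nat in sequentially. \<forall>p::real. 0 \<le> p \<and> p \<le> 1 \<and> p \<ge> (864 + K) / sqrt n \<longrightarrow>
      measure_pmf.prob (gnp n p) {G. contains_ham_cycle_square G} \<ge> 1 - \<epsilon>"
    using eventually_ge_at_top[of 1296]
  proof eventually_elim
    case (elim n)
    show ?case
      using prob_gnp_contains_ham_cycle_square_ge[OF K(1) elim(2)] elim(1) K(2) by fastforce
  qed
  then show ?thesis
    using K(1) by (intro exI[of _ "864 + K"]) auto
qed

end
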